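(* For the crossed quadratic lattice, the entropy constant $\eta=\lim_{m,n\to\infty} f(m,n)^{1/((m+1)(n+1))}$ exists and satisfies $$1.342542258\le \eta\le 1.342652573 .$$
   Context: For positive integers $m,n$ the crossed quadratic lattice graph $\check G_{m,n}$ has vertices $(i,j)$ with $0\le i\le m$, $0\le j\le n$, two distinct vertices $(i,j),(i',j')$ being adjacent iff $|i-i'|\le 1$ and $|j-j'|\le 1$ (the grid graph with both diagonals added in each unit square). $f(m,n)$ is the number of independent sets (the empty set included) of $\check G_{m,n}$, and the limit is the double limit with $m,n\to\infty$ independently. *)

theory Defs
  imports "HOL-Analysis.Analysis" "HOL-Library.Ramsey"
begin

definition lattice_verts :: "nat \<Rightarrow> nat \<Rightarrow> (nat \<times> nat) set" where
  "lattice_verts m n = {0..m} \<times> {0..n}"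

text \<open>Edges are unordered pairs, as expected by \<^const>\<open>indep\<close>. The coordinates are
  coerced to integers because subtraction on the naturals truncates.\<close>

definition crossed_lattice_edges :: "nat \<Rightarrow> nat \<Rightarrow> (nat \<times> nat) set set" where
  "crossed_lattice_edges m n =
     {{(i, j), (i', j')} | i j i' j'.
        (i, j) \<in> lattice_verts m n \<and> (i', j') \<in> lattice_verts m n \<and> (i, j) \<noteq> (i', j') \<and>
        \<bar>int i - int i'\<bar> \<le> 1 \<and> \<bar>int j - int j'\<bar> \<le> 1}"

definition num_indep_sets :: "nat \<Rightarrow> nat \<Rightarrow> nat" where
  "num_indep_sets m n =
     card {S. S \<subseteq> lattice_verts m n \<and> indep S (crossed_lattice_edges m n)}"

end

(*
Idea. Let W be the transfer matrix of the strip with m rows, so that the entries of W^k count the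
king configurations of a strip of k + 1 columns with prescribed first and last column.

Lower bound: W is symmetric, hence the number of configurations of an m x (2b + 1) strip is a squared
norm, thus log-convex in b, and the ratio of the counts for widths 13 and 11 bounds the growth per
two columns from below. Upper bound: the Frobenius norm is submultiplicative, so the growth per six
columns is at most the Frobenius norm of W^6, whose square counts the configurations on a cylinder of
circumference 12. In the other direction, growth rates of strips and cylinders of fixed width are
bounded by testing their transfer matrices on a positive vector (Collatz-Wielandt).
The limit exists because the logarithm of the count is subadditive in both side lengths.
*)
theory Submission
  imports Defs "HOL-Library.Product_Order" "HOL-Real_Asymp.Real_Asymp"
begin

subsection \<open>Counting walks\<close>

text \<open>Both bounds are read off along one path of the double limit: once existence is known,
  both side lengths may grow proportionally to k. A fixed-width estimate
  \<open>C * \<mu> ^ k\<close> is then raised to a power of order k, so C contributes only a factor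
  exponential in k against order k^2 cells and may be arbitrary. Subadditivity bounds the limit only
  from above, which is why the other side needs log-convexity; the quotient of two widths cancels
  the boundary effect that a single width carries. The widths are odd because only an even number of
  steps makes the count a squared norm. The Frobenius norm stands in for the spectral radius: its
  square is a trace of an even power of W, so eigenvalues of W need not be discussed. Flattening the
  cylinder puts two cells on each inner site and turns it into a strip over letters in
  \<open>bool \<times> bool\<close>; columns are therefore developed over a general bounded lattice
  of letters, and the same lemmas serve both transfer matrices.\<close>

primrec walks :: "'s set \<Rightarrow> ('s \<Rightarrow> 's \<Rightarrow> bool) \<Rightarrow> nat \<Rightarrow> 's \<Rightarrow> 's \<Rightarrow> real" where
  "walks X R 0 s t = of_bool (s = t)"
| "walks X R (Suc k) s t = (\<Sum>u\<in>X. walks X R k s u * of_bool (R u t))"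

definition total_walks :: "'s set \<Rightarrow> ('s \<Rightarrow> 's \<Rightarrow> bool) \<Rightarrow> nat \<Rightarrow> real" where
  "total_walks X R k = (\<Sum>s\<in>X. \<Sum>t\<in>X. walks X R k s t)"

text \<open>The squared Frobenius norm of a matrix power, left without the root; for symmetric
  \<open>R\<close> it is the trace of the power with exponent \<open>2 * k\<close>.\<close>

definition walks_frobenius :: "'s set \<Rightarrow> ('s \<Rightarrow> 's \<Rightarrow> bool) \<Rightarrow> nat \<Rightarrow> real" where
  "walks_frobenius X R k = (\<Sum>s\<in>X. \<Sum>t\<in>X. (walks X R k s t)\<^sup>2)"

lemma walks_nonneg: "walks X R k s t \<ge> 0"
  by (induction k arbitrary: t) (auto intro!: sum_nonneg)

lemma walks_add:
  assumes "finite X" "t \<in> X"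
  shows "walks X R (a + b) s t = (\<Sum>u\<in>X. walks X R a s u * walks X R b u t)"
  using assms(2)
proof (induction b arbitrary: t)
  case 0
  then show ?case using assms(1) by (simp add: of_bool_def sum.delta' if_distrib cong: if_cong)
next
  case (Suc b)
  have "walks X R (a + Suc b) s t
      = (\<Sum>v\<in>X. (\<Sum>u\<in>X. walks X R a s u * walks X R b u v) * of_bool (R v t))"
    using Suc.IH by simp
  also have "\<dots> = (\<Sum>v\<in>X. \<Sum>u\<in>X. walks X R a s u * (walks X R b u v * of_bool (R v t)))"
    by (simp add: sum_distrib_right mult.assoc)
  also have "\<dots> = (\<Sum>u\<in>X. walks X R a s u * walks X R (Suc b) u t)"
    by (subst sum.swap) (simp add: sum_distrib_left)
  finally show ?case .
qed

lemma walks_sym: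
  assumes "finite X" "symp R" "s \<in> X" "t \<in> X"
  shows "walks X R k s t = walks X R k t s"
  using assms(3,4)
proof (induction k arbitrary: s t)
  case 0
  then show ?case by auto
next
  case (Suc k)
  have one: "walks X R (Suc 0) u v = of_bool (R u v)" if "u \<in> X" for u v
    using that assms(1) by (simp add: of_bool_def sum.delta if_distrib [of "\<lambda>x. x * _"] cong: if_cong)
  have "walks X R (Suc k) s t = (\<Sum>u\<in>X. walks X R k s u * of_bool (R u t))"
    by simp
  also have "\<dots> = (\<Sum>u\<in>X. walks X R (Suc 0) t u * walks X R k u s)"
    using Suc assms(2) by (intro sum.cong) (auto simp: one dest: sympD simp del: walks.simps)
  also have "\<dots> = walks X R (Suc 0 + k) t s"
    using walks_add [OF assms(1) Suc.prems(1), of R "Suc 0" k t] by simp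
  finally show ?case by simp
qed

text \<open>Cutting a walk after \<open>a\<close> steps and reversing the first piece yields two
  walks from a common state, so the total is an inner product of row sums of two powers.
  Log-convexity is then Cauchy-Schwarz.\<close>

lemma total_walks_add:
  assumes "finite X" "symp R"
  shows "total_walks X R (a + b)
    = (\<Sum>u\<in>X. (\<Sum>t\<in>X. walks X R a u t) * (\<Sum>t\<in>X. walks X R b u t))"
proof -
  have "total_walks X R (a + b) = (\<Sum>s\<in>X. \<Sum>t\<in>X. \<Sum>u\<in>X. walks X R a u s * walks X R b u t)"
    unfolding total_walks_def
    by (intro sum.cong refl) (auto simp: walks_add [OF assms(1)] walks_sym [OF assms, of _ _ a] intro!: sum.cong)
  also have "\<dots> = (\<Sum>s\<in>X. \<Sum>u\<in>X. \<Sum>t\<in>X. walks X R a u s * walks X R b u t)"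
    by (intro sum.cong refl sum.swap)
  also have "\<dots> = (\<Sum>u\<in>X. \<Sum>s\<in>X. \<Sum>t\<in>X. walks X R a u s * walks X R b u t)"
    by (rule sum.swap)
  finally show ?thesis by (simp add: sum_product)
qed

lemma total_walks_log_convex:
  assumes "finite X" "symp R"
  shows "(total_walks X R (a + b))\<^sup>2 \<le> total_walks X R (2 * a) * total_walks X R (2 * b)"
  using Cauchy_Schwarz_ineq_sum [of "\<lambda>u. \<Sum>t\<in>X. walks X R a u t" "\<lambda>u. \<Sum>t\<in>X. walks X R b u t" X]
  by (simp add: mult_2 total_walks_add [OF assms] power2_eq_square)

section \<open>Frobenius norm of matrix powers\<close>

lemma walks_frobenius_nonneg: "walks_frobenius X R k \<ge> 0"
  by (auto simp: walks_frobenius_def intro!: sum_nonneg)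

lemma walks_frobenius_add_le:
  assumes "finite X"
  shows "walks_frobenius X R (a + b) \<le> walks_frobenius X R a * walks_frobenius X R b"
proof -
  have "walks_frobenius X R (a + b)
      \<le> (\<Sum>s\<in>X. \<Sum>t\<in>X. (\<Sum>u\<in>X. (walks X R a s u)\<^sup>2) * (\<Sum>u\<in>X. (walks X R b u t)\<^sup>2))"
    unfolding walks_frobenius_def
    by (intro sum_mono) (simp add: walks_add [OF assms] Cauchy_Schwarz_ineq_sum)
  also have "\<dots> = walks_frobenius X R a * (\<Sum>t\<in>X. \<Sum>u\<in>X. (walks X R b u t)\<^sup>2)"
    by (simp add: walks_frobenius_def sum_product)
  also have "(\<Sum>t\<in>X. \<Sum>u\<in>X. (walks X R b u t)\<^sup>2) = walks_frobenius X R b"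
    unfolding walks_frobenius_def by (rule sum.swap)
  finally show ?thesis .
qed

text \<open>Exponents start at one because the zeroth power is the identity, whose squared norm is
  \<open>card X\<close> rather than 1.\<close>

lemma walks_frobenius_mult_le:
  assumes "finite X"
  shows "walks_frobenius X R (k * Suc j) \<le> walks_frobenius X R k ^ Suc j"
proof (induction j)
  case (Suc j)
  have "walks_frobenius X R (k + k * Suc j) \<le> walks_frobenius X R k * walks_frobenius X R k ^ Suc j"
    by (intro order.trans [OF walks_frobenius_add_le [OF assms]] mult_left_mono Suc walks_frobenius_nonneg)
  then show ?case by simp
qed auto

text \<open>Cauchy-Schwarz against the all-one matrix; the factor lost does not depend on the number
  of steps.\<close>

lemma total_walks_le_frobenius:
  "(total_walks X R k)\<^sup>2 \<le> (real (card X))\<^sup>2 * walks_frobenius X R k"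
proof -
  have "(total_walks X R k)\<^sup>2 = (\<Sum>p\<in>X \<times> X. 1 * walks X R k (fst p) (snd p))\<^sup>2"
    by (simp add: total_walks_def sum.cartesian_product case_prod_unfold)
  also have "\<dots> \<le> (\<Sum>p\<in>X \<times> X. 1\<^sup>2) * (\<Sum>p\<in>X \<times> X. (walks X R k (fst p) (snd p))\<^sup>2)"
    by (rule Cauchy_Schwarz_ineq_sum)
  also have "\<dots> = (real (card X))\<^sup>2 * walks_frobenius X R k"
    by (simp add: walks_frobenius_def sum.cartesian_product case_prod_unfold
        card_cartesian_product power2_eq_square)
  finally show ?thesis .
qed

section \<open>Collatz-Wielandt bounds\<close>

lemma weighted_walks_Suc:
  "(\<Sum>t\<in>X. walks X R (Suc k) s t * v t)
    = (\<Sum>u\<in>X. walks X R k s u * (\<Sum>t\<in>{t\<in>X. R u t}. v t))" if "finite X"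
proof -
  have "(\<Sum>t\<in>X. walks X R (Suc k) s t * v t)
      = (\<Sum>t\<in>X. \<Sum>u\<in>X. walks X R k s u * (of_bool (R u t) * v t))"
    by (simp add: sum_distrib_right mult.assoc)
  also have "\<dots> = (\<Sum>u\<in>X. walks X R k s u * (\<Sum>t\<in>X. of_bool (R u t) * v t))"
    by (subst sum.swap) (simp add: sum_distrib_left)
  also have "\<dots> = (\<Sum>u\<in>X. walks X R k s u * (\<Sum>t\<in>{t\<in>X. R u t}. v t))"
    by (simp add: sum.inter_filter that of_bool_def if_distrib [of "\<lambda>x. x * _"] cong: if_cong)
  finally show ?thesis .
qed

text \<open>The matrix maps \<open>v\<close> below \<open>L * v\<close>, and
  \<open>v \<ge> 1\<close> lets \<open>v\<close> dominate the all-one vector with which the total is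
  formed.\<close>

lemma total_walks_le:
  assumes fin: "finite X" and v: "\<And>s. s \<in> X \<Longrightarrow> v s \<ge> 1" and "L \<ge> 0"
    and le: "\<And>s. s \<in> X \<Longrightarrow> (\<Sum>t\<in>{t\<in>X. R s t}. v t) \<le> L * v s"
  shows "total_walks X R k \<le> (\<Sum>s\<in>X. v s) * L ^ k"
proof -
  have *: "(\<Sum>t\<in>X. walks X R k s t * v t) \<le> L ^ k * v s" if "s \<in> X" for s
  proof (induction k)
    case 0
    then show ?case using fin that by (simp add: of_bool_def if_distrib [of "\<lambda>x. x * _"] sum.delta cong: if_cong)
  next
    case (Suc k)
    have "(\<Sum>t\<in>X. walks X R (Suc k) s t * v t) \<le> (\<Sum>u\<in>X. walks X R k s u * (L * v u))"
      unfolding weighted_walks_Suc [OF fin] by (intro sum_mono mult_left_mono le walks_nonneg)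
    also have "\<dots> = L * (\<Sum>u\<in>X. walks X R k s u * v u)"
      by (simp add: sum_distrib_left algebra_simps)
    also have "\<dots> \<le> L * (L ^ k * v s)"
      by (intro mult_left_mono Suc assms)
    finally show ?case by simp
  qed
  have "total_walks X R k \<le> (\<Sum>s\<in>X. \<Sum>t\<in>X. walks X R k s t * v t)"
    unfolding total_walks_def
  proof (intro sum_mono)
    fix s t assume "t \<in> X"
    show "walks X R k s t \<le> walks X R k s t * v t"
      using mult_left_mono [OF v [OF \<open>t \<in> X\<close>] walks_nonneg [of X R k s t]] by simp
  qed
  also have "\<dots> \<le> (\<Sum>s\<in>X. L ^ k * v s)"
    by (intro sum_mono *)
  finally show ?thesis by (simp add: sum_distrib_right mult.commute)
qed

text \<open>The scale of \<open>v\<close> is free: each entry is bounded by the sum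
  \<open>V\<close>, and \<open>V\<close> cancels, so no constant remains in front of
  \<open>L ^ k\<close>.\<close>

lemma total_walks_ge:
  assumes fin: "finite X" and v: "\<And>s. s \<in> X \<Longrightarrow> v s > 0" and "X \<noteq> {}" and "L \<ge> 0"
    and ge: "\<And>s. s \<in> X \<Longrightarrow> L * v s \<le> (\<Sum>t\<in>{t\<in>X. R s t}. v t)"
  shows "L ^ k \<le> total_walks X R k"
proof -
  have *: "L ^ k * v s \<le> (\<Sum>t\<in>X. walks X R k s t * v t)" if "s \<in> X" for s
  proof (induction k)
    case 0
    then show ?case using fin that by (simp add: of_bool_def if_distrib [of "\<lambda>x. x * _"] sum.delta cong: if_cong)
  next
    case (Suc k)
    have "L * (L ^ k * v s) \<le> L * (\<Sum>u\<in>X. walks X R k s u * v u)"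
      by (intro mult_left_mono Suc assms)
    also have "\<dots> = (\<Sum>u\<in>X. walks X R k s u * (L * v u))"
      by (simp add: sum_distrib_left algebra_simps)
    also have "\<dots> \<le> (\<Sum>t\<in>X. walks X R (Suc k) s t * v t)"
      unfolding weighted_walks_Suc [OF fin] by (intro sum_mono mult_left_mono ge walks_nonneg)
    finally show ?case by simp
  qed
  define V where "V = (\<Sum>s\<in>X. v s)"
  have "V > 0" unfolding V_def using assms by (intro sum_pos) auto
  have "L ^ k * V \<le> (\<Sum>s\<in>X. \<Sum>t\<in>X. walks X R k s t * v t)"
    unfolding V_def sum_distrib_left by (intro sum_mono *)
  also have "\<dots> \<le> (\<Sum>s\<in>X. \<Sum>t\<in>X. walks X R k s t * V)"
    unfolding V_def using fin v
    by (intro sum_mono mult_left_mono walks_nonneg member_le_sum) (auto intro: less_imp_le)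
  also have "\<dots> = total_walks X R k * V"
    by (simp add: total_walks_def sum_distrib_right)
  finally show ?thesis using \<open>V > 0\<close> by simp
qed

subsection \<open>Doubly subadditive functions\<close>

text \<open>The setting of Fekete's lemma in two variables. The values at 0 cover zero quotients and
  empty remainders in the divisions below.\<close>

locale doubly_subadditive =
  fixes h :: "nat \<Rightarrow> nat \<Rightarrow> real"
  assumes nonneg: "h a n \<ge> 0"
    and add_left: "h (a + b) n \<le> h a n + h b n"
    and add_right: "h n (a + b) \<le> h n a + h n b"
    and zero_left: "h 0 n = 0"
    and zero_right: "h n 0 = 0"
begin

lemma mult_left: "h (q * a) n \<le> real q * h a n"
proof (induction q)
  case (Suc q)
  then show ?case using add_left [of a "q * a" n] by (simp add: algebra_simps)
qed (simp add: zero_left)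

lemma mult_right: "h n (q * a) \<le> real q * h n a"
proof (induction q)
  case (Suc q)
  then show ?case using add_right [of n a "q * a"] by (simp add: algebra_simps)
qed (simp add: zero_right)

lemma le_mult_one: "h a b \<le> real a * real b * h 1 1"
proof -
  have "h a b \<le> real a * h 1 b" using mult_left [of a 1 b] by simp
  also have "\<dots> \<le> real a * (real b * h 1 1)"
    using mult_right [of 1 b 1] by (intro mult_left_mono) auto
  finally show ?thesis by simp
qed

text \<open>Division with remainder in both directions: the large rectangle splits into
  \<open>q * q'\<close> copies of the small one and remainder strips, which cost at most
  \<open>h 1 1\<close> per cell.\<close>

lemma quotient_le:
  assumes "a > 0" "b > 0" "M > 0" "N > 0"
  shows "h M N / (real M * real N)
    \<le> h a b / (real a * real b) + (real a / real M + real b / real N) * h 1 1"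
proof -
  define q r q' r' where "q = M div a" "r = M mod a" "q' = N div b" "r' = N mod b"
  note defs = this
  have M: "M = q * a + r" and N: "N = q' * b + r'" by (simp_all add: defs)
  have rs: "r \<le> a" "r' \<le> b" using assms by (auto simp: defs less_imp_le)
  let ?C = "h 1 1"
  have C: "?C \<ge> 0" by (rule nonneg)
  have qM: "real q * real a \<le> real M" and qN: "real q' * real b \<le> real N"
    using M N by (metis le_add1 of_nat_le_iff of_nat_mult)+
  have *: "h a N \<le> real q' * h a b + real a * real b * ?C"
  proof -
    have "h a N \<le> h a (q' * b) + h a r'" unfolding N by (rule add_right)
    also have "\<dots> \<le> real q' * h a b + real a * real r' * ?C"
      by (intro add_mono mult_right le_mult_one)
    also have "\<dots> \<le> real q' * h a b + real a * real b * ?C"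
      using rs C by (intro add_left_mono mult_mono) auto
    finally show ?thesis .
  qed
  have "h M N \<le> h (q * a) N + h r N" unfolding M by (rule add_left)
  also have "\<dots> \<le> real q * h a N + real r * real N * ?C"
    by (intro add_mono mult_left le_mult_one)
  also have "\<dots> \<le> real q * (real q' * h a b + real a * real b * ?C) + real a * real N * ?C"
    using rs C * by (intro add_mono mult_left_mono mult_right_mono) auto
  also have "\<dots> = (real q * real a) * (real q' * real b) * (h a b / (real a * real b))
      + (real q * real a) * real b * ?C + real a * real N * ?C"
    using assms by (simp add: field_simps)
  also have "\<dots> \<le> real M * real N * (h a b / (real a * real b))
      + real M * real b * ?C + real a * real N * ?C"
    using qM qN C nonneg [of a b] by (intro add_mono mult_mono mult_right_mono) auto
  finally show ?thesis using assms by (simp add: field_simps)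
qed

text \<open>The limit is the infimum of all quotients. The error in \<open>quotient_le\<close> is a
  sum of two terms that each tend to 0 in one index alone, as a limit along the product filter
  requires.\<close>

lemma convergent:
  "\<exists>L. ((\<lambda>(m, n). h (Suc m) (Suc n) / (real (Suc m) * real (Suc n))) \<longlongrightarrow> L)
        (sequentially \<times>\<^sub>F sequentially)"
proof -
  define Q where "Q = (\<lambda>p. h (Suc (fst p)) (Suc (snd p)) / (real (Suc (fst p)) * real (Suc (snd p))))"
  define L where "L = (INF p. Q p)"
  have bdd: "bdd_below (range Q)"
    by (rule bdd_belowI [of _ 0]) (auto simp: Q_def nonneg)
  have "(Q \<longlongrightarrow> L) (sequentially \<times>\<^sub>F sequentially)"
  proof (rule order_tendstoI)
    fix x assume "x < L"
    then have "x < Q p" for p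
      using cINF_lower [OF bdd, of p] by (auto simp: L_def)
    then show "\<forall>\<^sub>F p in sequentially \<times>\<^sub>F sequentially. x < Q p" by simp
  next
    fix x assume "L < x"
    then obtain p where p: "Q p < x"
      unfolding L_def using cINF_less_iff [OF _ bdd] by auto
    obtain a b where ab: "p = (a, b)" by force
    let ?E = "\<lambda>q::nat\<times>nat. Q p + (real (Suc a) / real (Suc (fst q)) + real (Suc b) / real (Suc (snd q))) * h 1 1"
    have lim1: "((\<lambda>m. c / real (Suc m)) \<longlongrightarrow> 0) sequentially" for c
      using LIMSEQ_Suc [OF lim_const_over_n [of c]] by simp
    have f: "filterlim fst sequentially (sequentially \<times>\<^sub>F sequentially)"
      and s: "filterlim snd sequentially (sequentially \<times>\<^sub>F sequentially)"
      by (rule filterlim_fst filterlim_snd)+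
    have "(?E \<longlongrightarrow> Q p + (0 + 0) * h 1 1) (sequentially \<times>\<^sub>F sequentially)"
      by (intro tendsto_intros filterlim_compose [OF lim1 f] filterlim_compose [OF lim1 s])
    then have "\<forall>\<^sub>F q in sequentially \<times>\<^sub>F sequentially. ?E q < x"
      using p by (intro order_tendstoD) auto
    moreover have "Q q \<le> ?E q" for q
      using quotient_le [of "Suc a" "Suc b" "Suc (fst q)" "Suc (snd q)"] by (simp add: Q_def ab)
    ultimately show "\<forall>\<^sub>F q in sequentially \<times>\<^sub>F sequentially. Q q < x"
      by (auto elim!: eventually_mono intro: le_less_trans)
  qed
  then show ?thesis by (auto simp: Q_def case_prod_unfold)
qed

end

subsection \<open>Configurations of letters\<close>

text \<open>A letter is the set of occupied cells at one site, and cells clash componentwise.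
  \<open>bool\<close> means one cell per site, \<open>bool \<times> bool\<close> the two sheets of a
  flattened cylinder.\<close>

definition clash_free :: "'a::bounded_lattice \<Rightarrow> 'a \<Rightarrow> bool" where
  "clash_free x y \<longleftrightarrow> inf x y = bot"

lemma clash_free_bot [simp]: "clash_free bot x" "clash_free x bot"
  by (simp_all add: clash_free_def)

lemma clash_free_commute: "clash_free x y \<longleftrightarrow> clash_free y x"
  by (simp add: clash_free_def inf.commute)

lemma clash_free_bool: "clash_free x y \<longleftrightarrow> \<not> (x \<and> y)"
  by (simp add: clash_free_def)

lemma clash_free_Pair [simp]: "clash_free (a, b) (c, d) \<longleftrightarrow> clash_free a c \<and> clash_free b d"
  by (auto simp: clash_free_def bot_prod_def)

text \<open>Padding with \<open>bot\<close>, which clashes with nothing, makes columns total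
  functions and spares the clash conditions any boundary case. The alphabet varies with the height
  \<open>j\<close> because the folds of the cylinder admit fewer letters.\<close>

definition cols :: "(nat \<Rightarrow> 'a set) \<Rightarrow> nat \<Rightarrow> (nat \<Rightarrow> 'a::bounded_lattice) set" where
  "cols A n = {c. (\<forall>j<n. c j \<in> A j) \<and> (\<forall>j\<ge>n. c j = bot) \<and> (\<forall>j. clash_free (c j) (c (Suc j)))}"

definition fits :: "(nat \<Rightarrow> 'a::bounded_lattice) \<Rightarrow> (nat \<Rightarrow> 'a) \<Rightarrow> bool" where
  "fits c d \<longleftrightarrow>
    (\<forall>j. clash_free (c j) (d j) \<and> clash_free (c j) (d (Suc j)) \<and> clash_free (c (Suc j)) (d j))"

definition configs :: "(nat \<Rightarrow> 'a set) \<Rightarrow> nat \<Rightarrow> nat \<Rightarrow> (nat \<Rightarrow> nat \<Rightarrow> 'a::bounded_lattice) set" where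
  "configs A m n = {\<sigma>. (\<forall>i<m. \<sigma> i \<in> cols A n) \<and> (\<forall>i\<ge>m. \<sigma> i = (\<lambda>_. bot)) \<and>
     (\<forall>i. fits (\<sigma> i) (\<sigma> (Suc i)))}"

lemma fits_sym: "symp fits"
  by (auto simp: symp_def fits_def clash_free_commute)

lemma fits_bot [simp]: "fits (\<lambda>_. bot) c" "fits c (\<lambda>_. bot)"
  by (simp_all add: fits_def)

text \<open>Here the coordinates enter symmetrically apart from the alphabets, so transposing a
  configuration becomes a matter of inspection.\<close>

lemma configs_pointwise:
  "\<sigma> \<in> configs A m n \<longleftrightarrow>
    (\<forall>i<m. \<forall>j<n. \<sigma> i j \<in> A j) \<and> (\<forall>i j. i \<ge> m \<or> j \<ge> n \<longrightarrow> \<sigma> i j = bot) \<and>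
    (\<forall>i j. clash_free (\<sigma> i j) (\<sigma> i (Suc j)) \<and> clash_free (\<sigma> i j) (\<sigma> (Suc i) j) \<and>
       clash_free (\<sigma> i j) (\<sigma> (Suc i) (Suc j)) \<and> clash_free (\<sigma> i (Suc j)) (\<sigma> (Suc i) j))"
  (is "?L \<longleftrightarrow> ?R")
proof
  assume L: ?L
  have "clash_free (\<sigma> i j) (\<sigma> i (Suc j))" for i j
    using L by (cases "i < m") (auto simp: configs_def cols_def)
  then show ?R using L by (auto simp: configs_def cols_def fits_def) (metis not_le)+
next
  assume ?R
  then show ?L by (auto simp: configs_def cols_def fits_def)
qed

section \<open>Configurations as walks on columns\<close>

lemma finite_cols: "finite (cols A n :: (nat \<Rightarrow> 'a::{finite,bounded_lattice}) set)"
  by (rule finite_subset [OF _ finite_set_of_finite_funs [of "{..<n}" UNIV bot]])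
    (auto simp: cols_def)

lemma finite_configs: "finite (configs A m n :: (nat \<Rightarrow> nat \<Rightarrow> 'a::{finite,bounded_lattice}) set)"
  by (rule finite_subset [OF _ finite_set_of_finite_funs
        [of "{..<m}" "cols A n" "\<lambda>_. bot", OF _ finite_cols]])
    (auto simp: configs_def)

text \<open>\<open>Suc k\<close> columns make \<open>k\<close> steps, so one more step adds the
  column with index \<open>Suc k\<close>; removing it means resetting that index to the
  padding.\<close>

lemma configs_between_Suc:
  assumes "t \<in> cols A n"
  shows "{\<sigma> \<in> configs A (Suc (Suc k)) n. \<sigma> 0 = s \<and> \<sigma> (Suc k) = t}
    = (\<Union>u\<in>{u \<in> cols A n. fits u t}.
        (\<lambda>\<sigma>. \<sigma>(Suc k := t)) ` {\<sigma> \<in> configs A (Suc k) n. \<sigma> 0 = s \<and> \<sigma> k = u})" (is "?L = ?R")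
proof (intro set_eqI iffI)
  fix \<sigma> assume \<sigma>: "\<sigma> \<in> ?L"
  let ?\<tau> = "\<sigma>(Suc k := (\<lambda>_. bot))"
  have "?\<tau> i = (\<lambda>_. bot)" if "i \<ge> Suc k" for i
    using \<sigma> that by (cases "i = Suc k") (auto simp: configs_def)
  then have "?\<tau> \<in> configs A (Suc k) n"
    using \<sigma> by (auto simp: configs_def)
  moreover have "\<sigma> = ?\<tau>(Suc k := t)" using \<sigma> by auto
  moreover have "?\<tau> 0 = s" "?\<tau> k = \<sigma> k" using \<sigma> by auto
  moreover have "\<sigma> k \<in> cols A n" "fits (\<sigma> k) t" using \<sigma> by (auto simp: configs_def)
  ultimately show "\<sigma> \<in> ?R" by blast
next
  fix \<sigma> assume "\<sigma> \<in> ?R"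
  then obtain \<tau> where \<tau>: "\<tau> \<in> configs A (Suc k) n" "\<tau> 0 = s" "fits (\<tau> k) t"
    and \<sigma>: "\<sigma> = \<tau>(Suc k := t)" by auto
  have "fits (\<sigma> i) (\<sigma> (Suc i))" for i
  proof -
    consider "i < k" | "i = k" | "i = Suc k" | "i > Suc k" by linarith
    then show ?thesis
      using \<tau> unfolding \<sigma> by cases (auto simp: configs_def)
  qed
  then show "\<sigma> \<in> ?L" using \<tau> assms by (auto simp: configs_def \<sigma> less_Suc_eq)
qed

lemma card_configs_between:
  fixes A :: "nat \<Rightarrow> 'a::{finite,bounded_lattice} set"
  assumes "s \<in> cols A n" "t \<in> cols A n"
  shows "real (card {\<sigma> \<in> configs A (Suc k) n. \<sigma> 0 = s \<and> \<sigma> k = t})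
    = walks (cols A n) fits k s t"
  using assms(2)
proof (induction k arbitrary: t)
  case 0
  have "{\<sigma> \<in> configs A (Suc 0) n. \<sigma> 0 = s \<and> \<sigma> 0 = t}
      = (if s = t then {\<lambda>i. if i = 0 then s else (\<lambda>_. bot)} else {})"
    using assms(1) by (auto simp: configs_def fun_eq_iff)
  then show ?case by simp
next
  case (Suc k)
  let ?S = "\<lambda>u. {\<sigma> \<in> configs A (Suc k) n. \<sigma> 0 = s \<and> \<sigma> k = u}"
  let ?f = "\<lambda>\<sigma>. \<sigma>(Suc k := t)"
  \<comment> \<open>Index \<open>Suc k\<close> holds padding in all these configurations, so
    overwriting it loses nothing.\<close>
  have inj: "inj_on ?f (configs A (Suc k) n)"
  proof (rule inj_onI)
    fix \<sigma> \<tau> assume st: "\<sigma> \<in> configs A (Suc k) n" "\<tau> \<in> configs A (Suc k) n" and eq: "?f \<sigma> = ?f \<tau>"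
    show "\<sigma> = \<tau>"
    proof
      fix i show "\<sigma> i = \<tau> i"
        using fun_cong [OF eq, of i] st by (cases "i = Suc k") (auto simp: configs_def)
    qed
  qed
  have "card {\<sigma> \<in> configs A (Suc (Suc k)) n. \<sigma> 0 = s \<and> \<sigma> (Suc k) = t}
      = (\<Sum>u\<in>{u \<in> cols A n. fits u t}. card (?f ` ?S u))"
    unfolding configs_between_Suc [OF Suc.prems]
  proof (intro card_UN_disjoint ballI impI)
    fix u v :: "nat \<Rightarrow> 'a" assume "u \<noteq> v"
    then show "?f ` ?S u \<inter> ?f ` ?S v = {}"
      by (auto dest!: inj_onD [OF inj])
  qed (simp_all add: finite_cols finite_configs)
  also have "\<dots> = (\<Sum>u\<in>{u \<in> cols A n. fits u t}. card (?S u))"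
    by (intro sum.cong refl card_image inj_on_subset [OF inj]) auto
  finally show ?case
    by (simp add: Suc.IH sum.inter_filter finite_cols of_bool_def if_distrib [of "\<lambda>x. _ * x"] if_distrib [of real] cong: if_cong)
qed

lemma card_configs:
  fixes A :: "nat \<Rightarrow> 'a::{finite,bounded_lattice} set"
  shows "real (card (configs A (Suc k) n)) = total_walks (cols A n) fits k"
proof -
  let ?S = "\<lambda>p. {\<sigma> \<in> configs A (Suc k) n. \<sigma> 0 = fst p \<and> \<sigma> k = snd p}"
  have "\<sigma> 0 \<in> cols A n \<and> \<sigma> k \<in> cols A n" if "\<sigma> \<in> configs A (Suc k) n" for \<sigma>
    using that by (simp add: configs_def)
  then have "configs A (Suc k) n = (\<Union>p\<in>cols A n \<times> cols A n. ?S p)"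
    by fastforce
  then have "card (configs A (Suc k) n) = card (\<Union>p\<in>cols A n \<times> cols A n. ?S p)"
    by (rule arg_cong)
  also have "\<dots> = (\<Sum>p\<in>cols A n \<times> cols A n. card (?S p))"
    by (intro card_UN_disjoint ballI impI) (auto simp: finite_cols finite_configs prod_eq_iff)
  finally have "real (card (configs A (Suc k) n)) = (\<Sum>p\<in>cols A n \<times> cols A n. real (card (?S p)))"
    by (simp only: of_nat_sum)
  also have "\<dots> = (\<Sum>p\<in>cols A n \<times> cols A n. walks (cols A n) fits k (fst p) (snd p))"
    by (rule sum.cong [OF refl], rule card_configs_between) auto
  also have "\<dots> = total_walks (cols A n) fits k"
    by (simp only: total_walks_def sum.cartesian_product case_prod_unfold)
  finally show ?thesis .
qed

subsection \<open>The king graph\<close>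

abbreviation kings :: "nat \<Rightarrow> nat \<Rightarrow> (nat \<Rightarrow> nat \<Rightarrow> bool) set" where
  "kings \<equiv> configs (\<lambda>_. UNIV)"

lemma kings_iff:
  "\<sigma> \<in> kings m n \<longleftrightarrow>
    (\<forall>i j. \<sigma> i j \<longrightarrow> i < m \<and> j < n) \<and>
    (\<forall>i j. \<not> (\<sigma> i j \<and> \<sigma> i (Suc j)) \<and> \<not> (\<sigma> i j \<and> \<sigma> (Suc i) j) \<and>
       \<not> (\<sigma> i j \<and> \<sigma> (Suc i) (Suc j)) \<and> \<not> (\<sigma> i (Suc j) \<and> \<sigma> (Suc i) j))"
proof -
  have "(i \<ge> m \<or> j \<ge> n \<longrightarrow> \<sigma> i j = bot) \<longleftrightarrow> (\<sigma> i j \<longrightarrow> i < m \<and> j < n)" for i j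
    by auto
  then show ?thesis 
    unfolding configs_pointwise clash_free_bool by simp
qed

lemma kings_transpose: "(\<lambda>j i. \<sigma> i j) \<in> kings n m \<longleftrightarrow> \<sigma> \<in> kings m n"
  unfolding kings_iff by blast

lemma card_kings_commute: "card (kings m n) = card (kings n m)"
proof -
  have "(\<lambda>\<sigma> j i. \<sigma> i j) ` kings a b \<subseteq> kings b a" for a b
    by (rule image_subsetI) (rule kings_transpose [THEN iffD2])
  then have "bij_betw (\<lambda>\<sigma> j i. \<sigma> i j) (kings m n) (kings n m)"
    by (intro bij_betw_byWitness [of _ "\<lambda>\<sigma> j i. \<sigma> i j"]) auto
  then show ?thesis by (rule bij_betw_same_card)
qed

lemma card_kings_pos: "card (kings m n) \<ge> 1"
proof -
  have "(\<lambda>_ _. False) \<in> kings m n" by (simp add: kings_iff)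
  then have "card (kings m n) > 0"
    using finite_configs by (auto simp: card_gt_0_iff)
  then show ?thesis by simp
qed

lemma card_kings_0: "card (kings 0 n) = 1"
proof -
  have "\<sigma> \<in> kings 0 n \<longleftrightarrow> \<sigma> = (\<lambda>_ _. False)" for \<sigma>
    unfolding kings_iff fun_eq_iff by simp blast
  then have "kings 0 n = {\<lambda>_ _. False}" by blast
  then show ?thesis by simp
qed

text \<open>Cutting after \<open>a\<close> columns only forgets the constraints across the cut, and
  the two parts together determine the configuration.\<close>

lemma card_kings_add_le: "card (kings (a + b) n) \<le> card (kings a n) * card (kings b n)"
proof -
  let ?f = "\<lambda>\<sigma>. ((\<lambda>i j. i < a \<and> \<sigma> i j), (\<lambda>i. \<sigma> (a + i)))"
  have "card (kings (a + b) n) \<le> card (kings a n \<times> kings b n)"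
  proof (rule card_inj_on_le [of ?f])
    show "inj_on ?f (kings (a + b) n)"
    proof (rule inj_onI)
      fix \<sigma> \<tau> :: "nat \<Rightarrow> nat \<Rightarrow> bool" assume "?f \<sigma> = ?f \<tau>"
      then have fst: "(\<lambda>i j. i < a \<and> \<sigma> i j) = (\<lambda>i j. i < a \<and> \<tau> i j)"
        and snd: "(\<lambda>i. \<sigma> (a + i)) = (\<lambda>i. \<tau> (a + i))" by auto
      show "\<sigma> = \<tau>"
      proof
        fix i show "\<sigma> i = \<tau> i"
          using fun_cong [OF fst, of i] fun_cong [OF snd, of "i - a"] by (cases "i < a") auto
      qed
    qed
    show "?f ` kings (a + b) n \<subseteq> kings a n \<times> kings b n"
      by (auto simp: kings_iff) (metis nat_add_left_cancel_less)
  qed (simp add: finite_configs)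
  then show ?thesis by (simp add: card_cartesian_product)
qed

lemma card_cols: "card (cols (\<lambda>_. UNIV) n :: (nat \<Rightarrow> bool) set) = card (kings 1 n)"
proof (rule bij_betw_same_card [of "\<lambda>c i. if i = 0 then c else (\<lambda>_. bot)"],
    rule bij_betw_byWitness [of _ "\<lambda>\<sigma>. \<sigma> 0"])
qed (auto simp: configs_def fun_eq_iff fits_def clash_free_bool)

text \<open>The squared Frobenius norm counts pairs of king configurations with common first and last
  columns, that is, king configurations on a cylinder of circumference \<open>2 * k\<close>, read across
  the two glued strips.\<close>

lemma walks_frobenius_eq_card:
  assumes "k > 0"
  defines "A \<equiv> \<lambda>j. if j = 0 \<or> j = k then {(False, False), (True, True)} else UNIV"
  shows "walks_frobenius (cols (\<lambda>_. UNIV) n :: (nat \<Rightarrow> bool) set) fits k = real (card (configs A n (Suc k)))"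
proof -
  let ?X = "cols (\<lambda>_. UNIV) n :: (nat \<Rightarrow> bool) set"
  let ?S = "\<lambda>p. {\<sigma> \<in> kings (Suc k) n. \<sigma> 0 = fst p \<and> \<sigma> k = snd p}"
  let ?P = "\<Union>p\<in>?X \<times> ?X. ?S p \<times> ?S p"
  \<comment> \<open>The indices are swapped: the position along the height \<open>n\<close> of the
    two strips becomes the step, and their \<open>Suc k\<close> columns become the heights. The
    alphabets at heights 0 and \<open>k\<close> force the sheets to agree where they are
    glued.\<close>
  let ?f = "\<lambda>(\<sigma>, \<tau>). (\<lambda>i j. (\<sigma> j i, \<tau> j i))"
  have ends: "\<sigma> 0 \<in> ?X \<and> \<sigma> k \<in> ?X" if "\<sigma> \<in> kings (Suc k) n" for \<sigma>
    using that by (simp add: configs_def)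
  have P: "(\<sigma>, \<tau>) \<in> ?P \<longleftrightarrow> \<sigma> \<in> kings (Suc k) n \<and> \<tau> \<in> kings (Suc k) n \<and> \<sigma> 0 = \<tau> 0 \<and> \<sigma> k = \<tau> k"
    for \<sigma> \<tau> using ends [of \<sigma>] by auto
  \<comment> \<open>The alphabets give equality only for \<open>i < n\<close>; beyond that both
    configurations are padded.\<close>
  have row_eq: "(\<forall>i<n. \<sigma> j i = \<tau> j i) \<longleftrightarrow> \<sigma> j = \<tau> j"
    if "\<sigma> \<in> kings (Suc k) n" "\<tau> \<in> kings (Suc k) n" for \<sigma> \<tau> j
  proof -
    have "\<sigma> j i = \<tau> j i" if "\<not> i < n" for i
      using \<open>\<sigma> \<in> _\<close> \<open>\<tau> \<in> _\<close> that unfolding kings_iff by blast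
    then show ?thesis by (auto simp: fun_eq_iff)
  qed
  have eq: "?f (\<sigma>, \<tau>) \<in> configs A n (Suc k) \<longleftrightarrow> (\<sigma>, \<tau>) \<in> ?P" for \<sigma> \<tau>
  proof -
    have "?f (\<sigma>, \<tau>) \<in> configs A n (Suc k) \<longleftrightarrow> (\<forall>i<n. \<forall>j<Suc k. ?f (\<sigma>, \<tau>) i j \<in> A j) \<and>
       \<sigma> \<in> kings (Suc k) n \<and> \<tau> \<in> kings (Suc k) n"
      unfolding kings_transpose [of \<sigma>, symmetric] kings_transpose [of \<tau>, symmetric] configs_pointwise
      by (auto simp: bot_prod_def clash_free_bool)
    also have "\<dots> \<longleftrightarrow> (\<forall>i<n. \<sigma> 0 i = \<tau> 0 i) \<and> (\<forall>i<n. \<sigma> k i = \<tau> k i) \<and>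
       \<sigma> \<in> kings (Suc k) n \<and> \<tau> \<in> kings (Suc k) n"
    proof -
      have "(\<forall>j<Suc k. (\<sigma> j i, \<tau> j i) \<in> A j) \<longleftrightarrow> \<sigma> 0 i = \<tau> 0 i \<and> \<sigma> k i = \<tau> k i" for i
        by (auto simp: A_def)
      then show ?thesis by auto
    qed
    also have "\<dots> \<longleftrightarrow> (\<sigma>, \<tau>) \<in> ?P"
      unfolding P using row_eq by blast
    finally show ?thesis .
  qed
  have "card (configs A n (Suc k)) = card ?P"
  proof (rule bij_betw_same_card [symmetric, of ?f],
      rule bij_betw_byWitness [of _ "\<lambda>\<rho>. ((\<lambda>j i. fst (\<rho> i j)), (\<lambda>j i. snd (\<rho> i j)))"])
    show "?f ` ?P \<subseteq> configs A n (Suc k)"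
    proof
      fix \<rho> assume "\<rho> \<in> ?f ` ?P"
      then obtain p where "p \<in> ?P" "\<rho> = ?f p" by (elim imageE)
      then show "\<rho> \<in> configs A n (Suc k)" using eq [of "fst p" "snd p"] by (simp only: prod.collapse)
    qed
    show "(\<lambda>\<rho>. ((\<lambda>j i. fst (\<rho> i j)), (\<lambda>j i. snd (\<rho> i j)))) ` configs A n (Suc k) \<subseteq> ?P"
    proof (rule image_subsetI)
      fix \<rho> assume "\<rho> \<in> configs A n (Suc k)"
      then have "?f ((\<lambda>j i. fst (\<rho> i j)), (\<lambda>j i. snd (\<rho> i j))) \<in> configs A n (Suc k)" by simp
      then show "((\<lambda>j i. fst (\<rho> i j)), (\<lambda>j i. snd (\<rho> i j))) \<in> ?P" by (rule eq [THEN iffD1])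
    qed
  qed (simp_all add: case_prod_unfold)
  also have "card ?P = (\<Sum>p\<in>?X \<times> ?X. card (?S p \<times> ?S p))"
    by (intro card_UN_disjoint ballI impI) (auto simp: finite_cols finite_configs prod_eq_iff)
  finally have "real (card (configs A n (Suc k))) = (\<Sum>p\<in>?X \<times> ?X. real (card (?S p \<times> ?S p)))"
    by (simp only: of_nat_sum)
  also have "\<dots> = (\<Sum>p\<in>?X \<times> ?X. (walks ?X fits k (fst p) (snd p))\<^sup>2)"
  proof (rule sum.cong [OF refl])
    fix p assume "p \<in> ?X \<times> ?X"
    then have "real (card (?S p)) = walks ?X fits k (fst p) (snd p)"
      by (intro card_configs_between) auto
    then show "real (card (?S p \<times> ?S p)) = (walks ?X fits k (fst p) (snd p))\<^sup>2"
      by (simp only: card_cartesian_product power2_eq_square of_nat_mult)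
  qed
  also have "\<dots> = walks_frobenius ?X fits k"
    by (simp only: walks_frobenius_def sum.cartesian_product case_prod_unfold)
  finally show ?thesis by simp
qed

subsection \<open>Weighted trees of columns\<close>

text \<open>A tree stores one weight for every column, indexed by the letters of the column read from
  the bottom. The functions below are meant to be run by the simplifier: case distinctions are
  left to pattern matching, since \<open>if\<close> and \<open>case\<close> would let it rewrite inside dead branches.\<close>

datatype 'a wtree = Leaf nat | Node "('a \<times> 'a wtree) list"

primrec leaf_weight :: "'a wtree \<Rightarrow> nat" where
  "leaf_weight (Leaf w) = w"
| "leaf_weight (Node ts) = 0"

primrec subtrees :: "'a wtree \<Rightarrow> ('a \<times> 'a wtree) list" where
  "subtrees (Leaf w) = []"
| "subtrees (Node ts) = ts"

fun leaf_sum :: "('a \<times> 'a wtree) list \<Rightarrow> nat" where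
  "leaf_sum [] = 0"
| "leaf_sum ((y, t) # F) = leaf_weight t + leaf_sum F"

fun cons_if :: "bool \<Rightarrow> 'b \<Rightarrow> 'b list \<Rightarrow> 'b list" where
  "cons_if True x xs = x # xs"
| "cons_if False x xs = xs"

fun advance_subtrees where
  "advance_subtrees x0 x [] F = F"
| "advance_subtrees x0 x ((y, t) # ts) F =
    cons_if (clash_free x y \<and> clash_free x0 y) (y, t) (advance_subtrees x0 x ts F)"

fun advance_if :: "bool \<Rightarrow> 'a::bounded_lattice \<Rightarrow> 'a \<Rightarrow> 'a wtree \<Rightarrow> ('a \<times> 'a wtree) list \<Rightarrow> ('a \<times> 'a wtree) list" where
  "advance_if True x0 x t F = advance_subtrees x0 x (subtrees t) F"
| "advance_if False x0 x t F = F"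

fun advance :: "'a::bounded_lattice \<Rightarrow> 'a \<Rightarrow> ('a \<times> 'a wtree) list \<Rightarrow> ('a \<times> 'a wtree) list" where
  "advance x0 x [] = []"
| "advance x0 x ((y0, t) # F) = advance_if (clash_free x y0) x0 x t (advance x0 x F)"

text \<open>The list \<open>F\<close> holds the subtrees reachable along columns compatible with the letters
  read so far, each with its last letter; \<open>x0\<close> is the last letter read.\<close>

fun check :: "(nat \<Rightarrow> nat \<Rightarrow> bool) \<Rightarrow> 'a::bounded_lattice \<Rightarrow> ('a \<times> 'a wtree) list \<Rightarrow> 'a wtree \<Rightarrow> bool"
  and checks :: "(nat \<Rightarrow> nat \<Rightarrow> bool) \<Rightarrow> 'a \<Rightarrow> ('a \<times> 'a wtree) list \<Rightarrow> ('a \<times> 'a wtree) list \<Rightarrow> bool" where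
  "check P x0 F (Leaf w) \<longleftrightarrow> P w (leaf_sum F)"
| "check P x0 F (Node ts) \<longleftrightarrow> checks P x0 F ts"
| "checks P x0 F [] \<longleftrightarrow> True"
| "checks P x0 F ((x, t) # ts) \<longleftrightarrow> check P x (advance x0 x F) t \<and> checks P x0 F ts"

text \<open>This rules out a vacuous check: a tree that omits columns could still pass
  \<open>check\<close>, so the branching must follow exactly the admissible letters.\<close>

fun shape :: "'a::bounded_lattice list list \<Rightarrow> 'a \<Rightarrow> 'a wtree \<Rightarrow> bool"
  and shapes :: "'a list list \<Rightarrow> ('a \<times> 'a wtree) list \<Rightarrow> bool" where
  "shape [] x0 (Leaf w) \<longleftrightarrow> True"
| "shape [] x0 (Node ts) \<longleftrightarrow> False"
| "shape (A # As) x0 (Leaf w) \<longleftrightarrow> False"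
| "shape (A # As) x0 (Node ts) \<longleftrightarrow> map fst ts = filter (clash_free x0) A \<and> shapes As ts"
| "shapes As [] \<longleftrightarrow> True"
| "shapes As ((x, t) # ts) \<longleftrightarrow> shape As x t \<and> shapes As ts"

lemma shapes_iff: "shapes As ts \<longleftrightarrow> (\<forall>(x, t)\<in>set ts. shape As x t)"
  by (induction ts) auto

lemma checks_iff: "checks P x0 F ts \<longleftrightarrow> (\<forall>(x, t)\<in>set ts. check P x (advance x0 x F) t)"
  by (induction ts) auto

fun weight_at :: "'a wtree \<Rightarrow> 'a list \<Rightarrow> nat" where
  "weight_at (Leaf w) xs = w"
| "weight_at (Node ts) [] = 0"
| "weight_at (Node ts) (x # xs) = (\<Sum>(y, t)\<leftarrow>ts. if y = x then weight_at t xs else 0)"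

fun column_lists :: "'a::bounded_lattice list list \<Rightarrow> 'a \<Rightarrow> 'a list list" where
  "column_lists [] x0 = [[]]"
| "column_lists (A # As) x0 =
    concat (map (\<lambda>x. map ((#) x) (column_lists As x)) (filter (clash_free x0) A))"

fun lists_fit :: "'a::bounded_lattice \<Rightarrow> 'a \<Rightarrow> 'a list \<Rightarrow> 'a list \<Rightarrow> bool" where
  "lists_fit x0 y0 (x # xs) (y # ys) \<longleftrightarrow>
    clash_free x y \<and> clash_free x y0 \<and> clash_free x0 y \<and> lists_fit x y xs ys"
| "lists_fit x0 y0 _ _ \<longleftrightarrow> True"

text \<open>What one frontier entry still contributes: the weight of the completions below
  \<open>t\<close> that fit the remaining letters \<open>xs\<close>, where \<open>x0\<close> and
  \<open>y0\<close> are the last letters of the two columns. Its sum over the frontier is the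
  invariant of the traversal.\<close>

definition fit_weight :: "'a::bounded_lattice list list \<Rightarrow> 'a \<Rightarrow> 'a list \<Rightarrow> 'a \<times> 'a wtree \<Rightarrow> nat" where
  "fit_weight As x0 xs = (\<lambda>(y0, t).
    \<Sum>ys\<leftarrow>column_lists As y0. if lists_fit x0 y0 xs ys then weight_at t ys else 0)"

section \<open>Correctness of the tree check\<close>

lemma set_column_lists:
  "set (column_lists As x0) = {xs. length xs = length As \<and> (\<forall>j<length As. xs ! j \<in> set (As ! j)) \<and>
    (\<forall>j<length As. clash_free ((x0 # xs) ! j) (xs ! j))}"
proof (induction As arbitrary: x0)
  case (Cons A As)
  show ?case
  proof (rule set_eqI)
    fix xs
    have "xs \<in> set (column_lists (A # As) x0) \<longleftrightarrow>
        (\<exists>x ys. xs = x # ys \<and> x \<in> set A \<and> clash_free x0 x \<and> ys \<in> set (column_lists As x))"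
      by auto
    also have "\<dots> \<longleftrightarrow> xs \<in> {xs. length xs = length (A # As) \<and>
        (\<forall>j<length (A # As). xs ! j \<in> set ((A # As) ! j)) \<and>
        (\<forall>j<length (A # As). clash_free ((x0 # xs) ! j) (xs ! j))}"
      unfolding Cons.IH by (cases xs) (auto simp: All_less_Suc2)
    finally show "xs \<in> set (column_lists (A # As) x0) \<longleftrightarrow> \<dots>" .
  qed
qed simp

lemma distinct_column_lists:
  assumes "\<forall>A\<in>set As. distinct A"
  shows "distinct (column_lists As x0)"
  using assms
proof (induction As arbitrary: x0)
  case (Cons A As)
  have "distinct (concat (map (\<lambda>x. map ((#) x) (column_lists As x)) xs))" if "distinct xs" for xs
    using that Cons by (induction xs) (auto simp: distinct_map)
  with Cons.prems show ?case by simp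
qed simp

lemma weight_at_Node:
  assumes "distinct (map fst ts)" "(x, t) \<in> set ts"
  shows "weight_at (Node ts) (x # xs) = weight_at t xs"
proof -
  have "(\<Sum>(y, u)\<leftarrow>ts. if y = x then weight_at u xs else 0) = weight_at t xs"
    using assms
  proof (induction ts)
    case (Cons p ts)
    have "(\<Sum>(y, u)\<leftarrow>us. if y = x then weight_at u xs else 0) = 0" if "x \<notin> fst ` set us" for us
      using that by (induction us) auto
    note zero = this
    obtain y u where p: "p = (y, u)" by force
    show ?case
    proof (cases "y = x")
      case True
      then have notin: "x \<notin> fst ` set ts" using Cons.prems p by auto
      then have "(x, t) \<notin> set ts" by (metis fst_conv image_eqI)
      then show ?thesis using True Cons.prems p zero [OF notin] by simp
    next
      case False
      then show ?thesis using Cons p by simp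
    qed
  qed simp
  then show ?thesis by simp
qed

lemma fit_weight_Node:
  assumes ts: "map fst ts = filter (clash_free y0) A" and "distinct A"
  shows "fit_weight (A # As) x0 (x # xs) (y0, Node ts)
    = (if clash_free x y0
       then (\<Sum>(y, t)\<leftarrow>ts. if clash_free x y \<and> clash_free x0 y then fit_weight As x xs (y, t) else 0)
       else 0)"
proof -
  have dist: "distinct (map fst ts)" using assms by simp
  have "fit_weight (A # As) x0 (x # xs) (y0, Node ts)
      = (\<Sum>y\<leftarrow>map fst ts. \<Sum>ys\<leftarrow>column_lists As y.
          if lists_fit x0 y0 (x # xs) (y # ys) then weight_at (Node ts) (y # ys) else 0)"
  proof -
    have "(\<Sum>ys\<leftarrow>concat (map f xs). g ys) = (\<Sum>x\<leftarrow>xs. \<Sum>ys\<leftarrow>f x. g ys)"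
      for f :: "'a \<Rightarrow> 'a list list" and g :: "'a list \<Rightarrow> nat" and xs
      by (induction xs) auto
    then show ?thesis unfolding ts by (simp add: fit_weight_def o_def del: weight_at.simps lists_fit.simps)
  qed
  also have "\<dots> = (\<Sum>p\<leftarrow>ts. \<Sum>ys\<leftarrow>column_lists As (fst p).
          if lists_fit x0 y0 (x # xs) (fst p # ys) then weight_at (snd p) ys else 0)"
    using weight_at_Node [OF dist] 
    by (auto simp: o_def intro!: arg_cong [of _ _ sum_list] map_cong simp del: weight_at.simps)
  also have "\<dots> = (if clash_free x y0
       then (\<Sum>(y, t)\<leftarrow>ts. if clash_free x y \<and> clash_free x0 y then fit_weight As x xs (y, t) else 0)
       else 0)"
    by (auto simp: fit_weight_def case_prod_unfold intro!: arg_cong [of _ _ sum_list] map_cong)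
  finally show ?thesis .
qed

text \<open>The condition on \<open>x\<close> and \<open>y0\<close> concerns a whole subtree and is
  decided on entering it; those on \<open>y\<close> are decided child by child. Compatibility of
  \<open>y0\<close> with \<open>y\<close> is built into the tree.\<close>

lemma fit_weight_advance:
  assumes "distinct A" "\<forall>(y, t)\<in>set F. shape (A # As) y t"
  shows "(\<Sum>p\<leftarrow>F. fit_weight (A # As) x0 (x # xs) p) = (\<Sum>p\<leftarrow>advance x0 x F. fit_weight As x xs p)"
  using assms(2)
proof (induction x0 x F rule: advance.induct)
  case (2 x0 x y0 t F)
  then obtain ts where t: "t = Node ts" and ts: "map fst ts = filter (clash_free y0) A"
    by (cases t) auto
  have "(\<Sum>p\<leftarrow>advance_subtrees x0 x ts F. fit_weight As x xs p)
      = (\<Sum>(y, t)\<leftarrow>ts. if clash_free x y \<and> clash_free x0 y then fit_weight As x xs (y, t) else 0)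
        + (\<Sum>p\<leftarrow>F. fit_weight As x xs p)" for F
  proof (induction x0 x ts F rule: advance_subtrees.induct)
    case (2 x0 x y t ts F)
    then show ?case by (cases "clash_free x y \<and> clash_free x0 y") auto
  qed simp
  then show ?case
    using 2 fit_weight_Node [OF ts assms(1)] by (cases "clash_free x y0") (simp_all add: t)
qed simp

lemma shape_advance:
  assumes "\<forall>(y, t)\<in>set F. shape (A # As) y t" "(y, t) \<in> set (advance x0 x F)"
  shows "shape As y t"
  using assms
proof (induction x0 x F rule: advance.induct)
  case (2 x0 x y0 u F)
  then obtain us where u: "u = Node us" and us: "\<forall>(y, t)\<in>set us. shape As y t"
    by (cases u) (auto simp: shapes_iff)
  have "set (advance_subtrees x0 x us F) \<subseteq> set us \<union> set F" for F
  proof (induction x0 x us F rule: advance_subtrees.induct)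
    case (2 x0 x y t ts F)
    then show ?case by (cases "clash_free x y \<and> clash_free x0 y") auto
  qed simp
  then have "(y, t) \<in> set us \<union> set (advance x0 x F)"
    using 2(3) by (cases "clash_free x y0") (auto simp: u)
  then show ?case using 2 us by auto
qed simp

text \<open>The tree has two roles that separate on the way down: \<open>t\<close> follows the fixed
  column \<open>xs\<close>, while \<open>F\<close> collects the columns that still fit it. The
  induction on the height therefore treats them as independent; at the bottom each entry of
  \<open>F\<close> contributes its leaf.\<close>

lemma check_fit_weight:
  assumes "\<forall>A\<in>set As. distinct A" "shape As x0 t" "\<forall>(y, u)\<in>set F. shape As y u"
    "check P x0 F t" "xs \<in> set (column_lists As x0)"
  shows "P (weight_at t xs) (\<Sum>p\<leftarrow>F. fit_weight As x0 xs p)"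
  using assms
proof (induction As arbitrary: x0 t F xs)
  case Nil
  then obtain w where t: "t = Leaf w" by (cases t) auto
  have "leaf_sum F = (\<Sum>p\<leftarrow>F. fit_weight [] x0 [] p)"
    using Nil(3)
  proof (induction F rule: leaf_sum.induct)
    case (2 y u F)
    then show ?case by (cases u) (auto simp: fit_weight_def)
  qed simp
  with Nil t show ?case by simp
next
  case (Cons A As)
  then obtain ts where t: "t = Node ts" by (cases t) auto
  obtain x ys where xs: "xs = x # ys" "x \<in> set (filter (clash_free x0) A)" "ys \<in> set (column_lists As x)"
    using Cons.prems(5) by auto
  have ts: "map fst ts = filter (clash_free x0) A" "\<forall>(x, t)\<in>set ts. shape As x t"
    using Cons.prems(2) by (auto simp: t shapes_iff)
  have "x \<in> fst ` set ts" using xs(2) unfolding ts(1) [symmetric] by simp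
  then obtain u where u: "(x, u) \<in> set ts" by auto
  have "P (weight_at u ys) (\<Sum>p\<leftarrow>advance x0 x F. fit_weight As x ys p)"
  proof (rule Cons.IH)
    show "\<forall>(y, v)\<in>set (advance x0 x F). shape As y v"
      using shape_advance [OF Cons.prems(3)] by blast
    show "check P x (advance x0 x F) u"
      using Cons.prems(4) u by (auto simp: t checks_iff)
  qed (use Cons.prems ts u xs in auto)
  moreover have "weight_at t xs = weight_at u ys"
    unfolding t xs by (rule weight_at_Node) (use u ts Cons.prems in auto)
  moreover have "(\<Sum>p\<leftarrow>F. fit_weight (A # As) x0 xs p) = (\<Sum>p\<leftarrow>advance x0 x F. fit_weight As x ys p)"
    unfolding xs by (rule fit_weight_advance) (use Cons.prems in auto)
  ultimately show ?case by simp
qed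

text \<open>\<open>case_nat y0 d j\<close> is the letter of \<open>d\<close> just below height
  \<open>j\<close>, with \<open>y0\<close> under the bottom. The induction moves the first letters
  of the columns into \<open>x0\<close> and \<open>y0\<close>, which must therefore be
  arbitrary.\<close>

lemma lists_fit_map:
  "lists_fit x0 y0 (map c [0..<n]) (map d [0..<n]) \<longleftrightarrow>
    (\<forall>j<n. clash_free (c j) (d j) \<and> clash_free (c j) (case_nat y0 d j) \<and> clash_free (case_nat x0 c j) (d j))"
proof (induction n arbitrary: x0 y0 c d)
  case (Suc n)
  have shift: "case_nat (c 0) (\<lambda>i. c (Suc i)) j = c j" for c :: "nat \<Rightarrow> 'a" and j by (cases j) auto
  have "map c [0..<Suc n] = c 0 # map (\<lambda>i. c (Suc i)) [0..<n]" for c :: "nat \<Rightarrow> 'a"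
    by (simp add: map_upt_Suc del: upt_Suc)
  then show ?case
    by (simp add: Suc.IH shift All_less_Suc2 del: upt_Suc)
qed simp

text \<open>A diagonal condition is indexed by its lower site in \<open>fits\<close> and by its
  upper site in \<open>lists_fit\<close>; \<open>bot\<close> below the bottom and padding above the
  top absorb the shift.\<close>

lemma fits_iff_lists_fit:
  assumes "c \<in> cols A n" "d \<in> cols A n"
  shows "fits c d \<longleftrightarrow> lists_fit bot bot (map c [0..<n]) (map d [0..<n])"
proof
  assume "fits c d"
  then show "lists_fit bot bot (map c [0..<n]) (map d [0..<n])"
    by (auto simp: lists_fit_map fits_def split: nat.split)
next
  assume *: "lists_fit bot bot (map c [0..<n]) (map d [0..<n])"
  have "clash_free (c j) (d j) \<and> clash_free (c j) (d (Suc j)) \<and> clash_free (c (Suc j)) (d j)" for j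
  proof -
    have "clash_free (c j) (d j)" for j
      using * assms by (cases "j < n") (auto simp: lists_fit_map cols_def)
    moreover have "clash_free (c j) (d (Suc j)) \<and> clash_free (c (Suc j)) (d j)"
      using * assms by (cases "Suc j < n") (auto simp: lists_fit_map cols_def dest: spec [of _ "Suc j"])
    ultimately show ?thesis by blast
  qed
  then show "fits c d" by (simp add: fits_def)
qed

lemma bij_betw_column_lists:
  assumes len: "length As = n" and As: "\<And>j. j < n \<Longrightarrow> set (As ! j) = A j"
  shows "bij_betw (\<lambda>c. map c [0..<n]) (cols A n) (set (column_lists As bot))"
proof (rule bij_betw_byWitness [of _ "\<lambda>xs j. if j < n then xs ! j else bot"])
  show "\<forall>c\<in>cols A n. (\<lambda>j. if j < n then map c [0..<n] ! j else bot) = c"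
    by (auto simp: cols_def)
  show "\<forall>xs\<in>set (column_lists As bot). map (\<lambda>j. if j < n then xs ! j else bot) [0..<n] = xs"
    by (auto simp: set_column_lists len intro!: nth_equalityI)
  show "(\<lambda>c. map c [0..<n]) ` cols A n \<subseteq> set (column_lists As bot)"
    by (auto simp: set_column_lists len As cols_def nth_Cons split: nat.split)
  show "(\<lambda>xs j. if j < n then xs ! j else bot) ` set (column_lists As bot) \<subseteq> cols A n"
  proof (rule image_subsetI)
    fix xs assume xs: "xs \<in> set (column_lists As bot)"
    have "clash_free (xs ! j) (xs ! Suc j)" if "Suc j < n" for j
      using xs that by (auto simp: set_column_lists len dest!: spec [of _ "Suc j"])
    then show "(\<lambda>j. if j < n then xs ! j else bot) \<in> cols A n"
      using xs by (auto simp: cols_def set_column_lists len As)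
  qed
qed

text \<open>The initial frontier is the whole tree under the letter \<open>bot\<close>, so it stands
  for all columns, and the sum tested at a leaf is one entry of the transfer matrix applied to
  \<open>v\<close>.\<close>

lemma tree_weight:
  fixes A :: "nat \<Rightarrow> 'a::{finite,bounded_lattice} set"
  assumes shape: "shape As bot t" and check: "check P bot [(bot, t)] t"
    and len: "length As = n" and As: "\<And>j. j < n \<Longrightarrow> set (As ! j) = A j"
    and dist: "\<forall>A\<in>set As. distinct A"
  obtains v :: "(nat \<Rightarrow> 'a) \<Rightarrow> nat"
    where "\<And>c. c \<in> cols A n \<Longrightarrow> P (v c) (\<Sum>d\<in>{d\<in>cols A n. fits c d}. v d)"
proof
  define v where "v = (\<lambda>c. weight_at t (map c [0..<n]))"
  fix c assume c: "c \<in> cols A n"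
  note bij = bij_betw_column_lists [OF len As]
  have "P (v c) (fit_weight As bot (map c [0..<n]) (bot, t))"
    using check_fit_weight [OF dist shape _ check, of "map c [0..<n]"] shape bij_betw_apply [OF bij c]
    by (simp add: v_def)
  also have "fit_weight As bot (map c [0..<n]) (bot, t)
      = (\<Sum>ys\<in>set (column_lists As bot). if lists_fit bot bot (map c [0..<n]) ys then weight_at t ys else 0)"
    by (simp add: fit_weight_def sum_list_distinct_conv_sum_set distinct_column_lists [OF dist])
  also have "\<dots> = (\<Sum>d\<in>cols A n. if lists_fit bot bot (map c [0..<n]) (map d [0..<n]) then v d else 0)"
    unfolding v_def by (rule sum.reindex_bij_betw [OF bij, symmetric])
  also have "\<dots> = (\<Sum>d\<in>cols A n. if fits c d then v d else 0)"
    by (intro sum.cong refl) (simp add: fits_iff_lists_fit [OF c])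
  also have "\<dots> = (\<Sum>d\<in>{d\<in>cols A n. fits c d}. v d)"
    by (simp add: sum.inter_filter finite_cols)
  finally show "P (v c) (\<Sum>d\<in>{d\<in>cols A n. fits c d}. v d)" .
qed

text \<open>The rate \<open>p / q\<close> is cleared of its denominator so that checking a tree
  takes only arithmetic on naturals. The constant \<open>C\<close> found here is the total weight of
  all columns.\<close>

lemma card_configs_le:
  fixes A :: "nat \<Rightarrow> 'a::{finite,bounded_lattice} set"
  assumes "shape As bot t" "check (\<lambda>w s. 1 \<le> w \<and> q * s \<le> p * w) bot [(bot, t)] t"
    and "length As = n" "\<And>j. j < n \<Longrightarrow> set (As ! j) = A j" "\<forall>A\<in>set As. distinct A" "q > 0"
  obtains C where "\<And>k. real (card (configs A (Suc k) n)) \<le> C * (real p / real q) ^ k"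
proof -
  obtain v where v: "\<And>c. c \<in> cols A n \<Longrightarrow> 1 \<le> v c \<and> q * (\<Sum>d\<in>{d\<in>cols A n. fits c d}. v d) \<le> p * v c"
    using tree_weight [OF assms(1-5)] by blast
  have "total_walks (cols A n) fits k \<le> (\<Sum>c\<in>cols A n. real (v c)) * (real p / real q) ^ k" for k
  proof (rule total_walks_le)
    fix c assume "c \<in> cols A n"
    then have le: "1 \<le> v c" "q * (\<Sum>d\<in>{d\<in>cols A n. fits c d}. v d) \<le> p * v c" using v by auto
    show "1 \<le> real (v c)" using le by simp
    have "real q * (\<Sum>d\<in>{d\<in>cols A n. fits c d}. real (v d)) \<le> real p * real (v c)"
      using le(2) unfolding of_nat_sum [symmetric] of_nat_mult [symmetric] of_nat_le_iff .
    then show "(\<Sum>d\<in>{d\<in>cols A n. fits c d}. real (v d)) \<le> real p / real q * real (v c)"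
      using assms(6) by (simp add: field_simps)
  qed (simp_all add: finite_cols)
  then show thesis unfolding card_configs [symmetric] by (rule that)
qed

lemma card_configs_ge:
  fixes A :: "nat \<Rightarrow> 'a::{finite,bounded_lattice} set"
  assumes "shape As bot t" "check (\<lambda>w s. 1 \<le> w \<and> p * w \<le> q * s) bot [(bot, t)] t"
    and "length As = n" "\<And>j. j < n \<Longrightarrow> set (As ! j) = A j" "\<forall>A\<in>set As. distinct A" "q > 0"
    and "cols A n \<noteq> {}"
  shows "(real p / real q) ^ k \<le> real (card (configs A (Suc k) n))"
proof -
  obtain v where v: "\<And>c. c \<in> cols A n \<Longrightarrow> 1 \<le> v c \<and> p * v c \<le> q * (\<Sum>d\<in>{d\<in>cols A n. fits c d}. v d)"
    using tree_weight [OF assms(1-5)] by blast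
  have "(real p / real q) ^ k \<le> total_walks (cols A n) fits k"
  proof (rule total_walks_ge)
    fix c assume "c \<in> cols A n"
    then have le: "1 \<le> v c" "p * v c \<le> q * (\<Sum>d\<in>{d\<in>cols A n. fits c d}. v d)" using v by auto
    show "0 < real (v c)" using le by simp
    have "real p * real (v c) \<le> real q * (\<Sum>d\<in>{d\<in>cols A n. fits c d}. real (v d))"
      using le(2) unfolding of_nat_sum [symmetric] of_nat_mult [symmetric] of_nat_le_iff .
    then show "real p / real q * real (v c) \<le> (\<Sum>d\<in>{d\<in>cols A n. fits c d}. real (v d))"
      using assms(6) by (simp add: field_simps)
  qed (simp_all add: finite_cols assms)
  then show ?thesis by (simp add: card_configs)
qed

lemma kings_le:
  assumes "shape (replicate n [False, True]) bot t"
    and "check (\<lambda>w s. 1 \<le> w \<and> q * s \<le> p * w) bot [(bot, t)] t" "q > 0"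
  obtains C where "\<And>k. real (card (kings (Suc k) n)) \<le> C * (real p / real q) ^ k"
  by (rule card_configs_le [OF assms(1,2), of n "\<lambda>_. UNIV"]) (use assms(3) in \<open>auto simp: UNIV_bool\<close>)

lemma kings_ge:
  assumes "shape (replicate n [False, True]) bot t"
    and "check (\<lambda>w s. 1 \<le> w \<and> p * w \<le> q * s) bot [(bot, t)] t" "q > 0"
  shows "(real p / real q) ^ k \<le> real (card (kings (Suc k) n))"
proof (rule card_configs_ge [OF assms(1,2)])
  have "(\<lambda>_. bot) \<in> cols (\<lambda>_. UNIV :: bool set) n" by (simp add: cols_def clash_free_bool)
  then show "cols (\<lambda>_. UNIV :: bool set) n \<noteq> {}" by blast
qed (use assms(3) in \<open>auto simp: UNIV_bool\<close>)

subsection \<open>The entropy constant\<close>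

lemma insert_in_crossed_lattice_edges_iff:
  "{(i, j), (i', j')} \<in> crossed_lattice_edges m n \<longleftrightarrow>
    i \<le> m \<and> j \<le> n \<and> i' \<le> m \<and> j' \<le> n \<and> (i, j) \<noteq> (i', j') \<and>
    \<bar>int i - int i'\<bar> \<le> 1 \<and> \<bar>int j - int j'\<bar> \<le> 1"
  unfolding crossed_lattice_edges_def lattice_verts_def
  by (auto simp: doubleton_eq_iff abs_minus_commute)

text \<open>\<open>kings\<close> records four of the eight directions; every other one is a recorded
  direction seen from its other end, which closes the case split over displacements.\<close>

lemma indep_iff_kings:
  "S \<subseteq> lattice_verts m n \<and> indep S (crossed_lattice_edges m n)
    \<longleftrightarrow> (\<lambda>i j. (i, j) \<in> S) \<in> kings (Suc m) (Suc n)" (is "?L \<longleftrightarrow> ?R")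
proof
  assume L: ?L
  have apart: "\<not> (\<bar>int i - int i'\<bar> \<le> 1 \<and> \<bar>int j - int j'\<bar> \<le> 1)"
    if "(i, j) \<in> S" "(i', j') \<in> S" "(i, j) \<noteq> (i', j')" for i j i' j'
  proof -
    have "i \<le> m \<and> j \<le> n \<and> i' \<le> m \<and> j' \<le> n"
      using L that by (auto simp: lattice_verts_def)
    moreover have "{(i, j), (i', j')} \<notin> crossed_lattice_edges m n"
      using L that unfolding indep_def by blast
    ultimately show ?thesis
      using that(3) unfolding insert_in_crossed_lattice_edges_iff by blast
  qed
  have "i < Suc m \<and> j < Suc n" if "(i, j) \<in> S" for i j
    using L that by (auto simp: lattice_verts_def)
  moreover have "\<not> ((i, j) \<in> S \<and> (i, Suc j) \<in> S)" "\<not> ((i, j) \<in> S \<and> (Suc i, j) \<in> S)"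
    "\<not> ((i, j) \<in> S \<and> (Suc i, Suc j) \<in> S)" "\<not> ((i, Suc j) \<in> S \<and> (Suc i, j) \<in> S)" for i j
    using apart [of i j i "Suc j"] apart [of i j "Suc i" j] apart [of i j "Suc i" "Suc j"]
      apart [of i "Suc j" "Suc i" j] by auto
  ultimately show ?R unfolding kings_iff by blast
next
  assume ?R
  then have R: "\<And>i j. (i, j) \<in> S \<Longrightarrow> i \<le> m \<and> j \<le> n"
    "\<And>i j. \<not> ((i, j) \<in> S \<and> (i, Suc j) \<in> S)" "\<And>i j. \<not> ((i, j) \<in> S \<and> (Suc i, j) \<in> S)"
    "\<And>i j. \<not> ((i, j) \<in> S \<and> (Suc i, Suc j) \<in> S)" "\<And>i j. \<not> ((i, Suc j) \<in> S \<and> (Suc i, j) \<in> S)"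
    unfolding kings_iff less_Suc_eq_le by blast+
  have "{(i, j), (i', j')} \<notin> crossed_lattice_edges m n"
    if "(i, j) \<in> S" "(i', j') \<in> S" "(i, j) \<noteq> (i', j')" for i j i' j'
  proof
    assume "{(i, j), (i', j')} \<in> crossed_lattice_edges m n"
    then have "i' = i \<or> i' = Suc i \<or> i = Suc i'" "j' = j \<or> j' = Suc j \<or> j = Suc j'"
      unfolding insert_in_crossed_lattice_edges_iff by linarith+
    then show False
      using that R(2) [of i j] R(2) [of i j'] R(3) [of i j] R(3) [of i' j] R(4) [of i j] R(4) [of i' j']
        R(5) [of i j'] R(5) [of i' j]
      by (elim disjE) simp_all
  qed
  then show ?L using R(1) by (auto simp: indep_def lattice_verts_def)
qed

lemma num_indep_sets_eq: "num_indep_sets m n = card (kings (Suc m) (Suc n))"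
  unfolding num_indep_sets_def
proof (rule bij_betw_same_card [of "\<lambda>S i j. (i, j) \<in> S"],
    rule bij_betw_byWitness [of _ "\<lambda>\<sigma>. {(i, j). \<sigma> i j}"])
  show "(\<lambda>\<sigma>. {(i, j). \<sigma> i j}) ` kings (Suc m) (Suc n)
      \<subseteq> {S. S \<subseteq> lattice_verts m n \<and> indep S (crossed_lattice_edges m n)}"
    unfolding indep_iff_kings by auto
  show "(\<lambda>S i j. (i, j) \<in> S) ` {S. S \<subseteq> lattice_verts m n \<and> indep S (crossed_lattice_edges m n)}
      \<subseteq> kings (Suc m) (Suc n)"
    unfolding indep_iff_kings by blast
qed simp_all

text \<open>Cutting gives one direction and transposition the other; a board with a side of length 0
  has only the empty configuration, hence logarithm 0.\<close>

interpretation log_kings: doubly_subadditive "\<lambda>a n. ln (real (card (kings a n)))"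
proof
  have pos: "0 < real (card (kings a n))" for a n
    using card_kings_pos [of a n] by simp
  show add: "ln (real (card (kings (a + b) n))) \<le> ln (real (card (kings a n))) + ln (real (card (kings b n)))"
    for a b n
  proof -
    have "real (card (kings (a + b) n)) \<le> real (card (kings a n)) * real (card (kings b n))"
      using card_kings_add_le [of a b n] unfolding of_nat_mult [symmetric] of_nat_le_iff .
    then have "ln (real (card (kings (a + b) n))) \<le> ln (real (card (kings a n)) * real (card (kings b n)))"
      using pos by (intro ln_mono) auto
    then show ?thesis using pos by (simp add: ln_mult)
  qed
  show "ln (real (card (kings n (a + b)))) \<le> ln (real (card (kings n a))) + ln (real (card (kings n b)))"
    for a b n
    using add [of a b n] by (simp only: card_kings_commute [of n])
  show "ln (real (card (kings 0 n))) = 0" for n by (simp add: card_kings_0)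
  show "ln (real (card (kings n 0))) = 0" for n by (simp add: card_kings_0 card_kings_commute [of n 0])
  show "0 \<le> ln (real (card (kings a n)))" for a n using card_kings_pos [of a n] by simp
qed

section \<open>From strip and cylinder rates to the entropy\<close>

text \<open>With an even number of steps the number of walks is a squared norm, so the sequence
  \<open>card (kings (2 * b + 1) m)\<close> is log-convex in \<open>b\<close>.\<close>

lemma card_kings_ratio_mono:
  fixes m :: nat
  defines "G \<equiv> \<lambda>b. real (card (kings (Suc (2 * b)) m))"
  shows "G (b + k) \<ge> G b * (G (Suc b) / G b) ^ k"
proof -
  have pos: "G b > 0" for b using card_kings_pos [of "Suc (2 * b)" m] by (simp add: G_def)
  have convex: "(G (Suc b))\<^sup>2 \<le> G b * G (Suc (Suc b))" for b
  proof -
    \<comment> \<open>\<open>Suc (2 * b)\<close> columns are \<open>2 * b\<close> steps;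
      log-convexity at \<open>b\<close> and \<open>b + 2\<close> has its middle at
      \<open>2 * Suc b\<close> and so links three consecutive odd widths.\<close>
    have "b + (b + 2) = 2 * Suc b" by simp
    then show ?thesis
      using total_walks_log_convex [OF finite_cols fits_sym, of "\<lambda>_. UNIV :: bool set" m b "b + 2"]
      unfolding G_def card_configs by (metis add_2_eq_Suc')
  qed
  have mono: "G (Suc b) / G b \<le> G (Suc (b + k)) / G (b + k)" for b k
  proof (induction k)
    case (Suc k)
    have "G (Suc (b + k)) / G (b + k) \<le> G (Suc (Suc (b + k))) / G (Suc (b + k))"
      using convex [of "b + k"] pos [of "b + k"] pos [of "Suc (b + k)"]
      by (simp add: field_simps power2_eq_square)
    with Suc show ?case by simp
  qed simp
  show ?thesis
  proof (induction k)
    case (Suc k)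
    have "G b * (G (Suc b) / G b) ^ Suc k = (G b * (G (Suc b) / G b) ^ k) * (G (Suc b) / G b)" by simp
    also have "\<dots> \<le> G (b + k) * (G (Suc (b + k)) / G (b + k))"
      using pos by (intro mult_mono Suc mono) (auto intro: less_imp_le)
    also have "\<dots> = G (b + Suc k)" using pos [of "b + k"] by simp
    finally show ?case .
  qed simp
qed

text \<open>After transposition, \<open>G (Suc b) / G b\<close> compares strips of heights
  \<open>2 * b + 3\<close> and \<open>2 * b + 1\<close> with the same \<open>k\<close> steps, so it
  is at least \<open>(\<nu> / \<mu>) ^ k / C\<close>. Each of \<open>k\<close> further pairs of
  columns gains at least this factor. The exponent is thus about \<open>k * k\<close> over about
  \<open>2 * k * k\<close> cells, and \<open>k * ln C\<close> is negligible.\<close>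

lemma kings_rate_lower:
  assumes L: "((\<lambda>(m, n). ln (real (card (kings (Suc m) (Suc n)))) / (real (Suc m) * real (Suc n))) \<longlongrightarrow> L)
      (sequentially \<times>\<^sub>F sequentially)"
    and le: "\<And>k. real (card (kings (Suc k) (Suc (2 * b)))) \<le> C * \<mu> ^ k"
    and ge: "\<And>k. \<nu> ^ k \<le> real (card (kings (Suc k) (Suc (2 * Suc b))))"
    and "\<mu> > 0" "\<nu> > 0"
  shows "ln (\<nu> / \<mu>) / 2 \<le> L"
proof (rule LIMSEQ_le)
  have diag: "filterlim (\<lambda>k::nat. (2 * (b + k), k)) (sequentially \<times>\<^sub>F sequentially) sequentially"
  proof (rule filterlim_Pair)
    show "filterlim (\<lambda>k. 2 * (b + k)) sequentially sequentially"
      by (rule filterlim_at_top_mono [OF filterlim_ident]) auto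
  qed (rule filterlim_ident)
  show "(\<lambda>k. ln (real (card (kings (Suc (2 * (b + k))) (Suc k)))) / (real (Suc (2 * (b + k))) * real (Suc k))) \<longlonglongrightarrow> L"
    using filterlim_compose [OF L diag] by simp
  show "(\<lambda>k. (real k * (real k * ln (\<nu> / \<mu>) - ln C)) / (real (Suc (2 * (b + k))) * real (Suc k)))
      \<longlonglongrightarrow> ln (\<nu> / \<mu>) / 2"
    by real_asymp
  have "C > 0" using le [of 0] card_kings_pos [of 1 "Suc (2 * b)"] by simp
  have "real k * (real k * ln (\<nu> / \<mu>) - ln C) \<le> ln (real (card (kings (Suc (2 * (b + k))) (Suc k))))" for k
  proof -
    define G where "G = (\<lambda>b. real (card (kings (Suc (2 * b)) (Suc k))))"
    have G1: "G b \<ge> 1" for b using card_kings_pos [of "Suc (2 * b)" "Suc k"] by (simp add: G_def)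
    have "(\<nu> / \<mu>) ^ k / C = \<nu> ^ k / (C * \<mu> ^ k)" by (simp add: power_divide)
    also have "\<dots> \<le> G (Suc b) / G b"
      using le [of k] ge [of k] \<open>\<nu> > 0\<close> G1 [of b] G1 [of "Suc b"]
      by (intro frac_le) (auto simp: G_def card_kings_commute [of _ "Suc k"])
    finally have "((\<nu> / \<mu>) ^ k / C) ^ k \<le> (G (Suc b) / G b) ^ k"
      using \<open>C > 0\<close> assms(4,5) by (intro power_mono) auto
    also have "\<dots> \<le> G b * (G (Suc b) / G b) ^ k"
      using mult_right_mono [OF G1 [of b], of "(G (Suc b) / G b) ^ k"] G1 [of b] G1 [of "Suc b"] by auto
    also have "\<dots> \<le> G (b + k)"
      using card_kings_ratio_mono [where m = "Suc k" and b = b and k = k] by (simp add: G_def)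
    finally have "ln (((\<nu> / \<mu>) ^ k / C) ^ k) \<le> ln (G (b + k))"
      using \<open>C > 0\<close> assms(4,5) by (intro ln_mono) auto
    then show ?thesis
      using \<open>C > 0\<close> assms(4,5) by (simp add: G_def ln_realpow ln_div algebra_simps)
  qed
  then show "\<exists>N. \<forall>k\<ge>N. (real k * (real k * ln (\<nu> / \<mu>) - ln C)) / (real (Suc (2 * (b + k))) * real (Suc k))
      \<le> ln (real (card (kings (Suc (2 * (b + k))) (Suc k)))) / (real (Suc (2 * (b + k))) * real (Suc k))"
    by (intro exI [of _ 0] allI impI divide_right_mono) auto
qed

text \<open>\<open>r * Suc k\<close> steps form \<open>Suc k\<close> blocks of \<open>r\<close>
  steps, each of squared norm at most \<open>C * \<mu> ^ k\<close>. Passing from the square to the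
  count halves the exponent, and there are about \<open>r * k * k\<close> cells, so the divisor is
  the circumference \<open>2 * r\<close>.\<close>

lemma kings_rate_upper:
  fixes r :: nat
  defines "A \<equiv> \<lambda>j. if j = 0 \<or> j = r then {(False, False), (True, True)} else UNIV"
  assumes L: "((\<lambda>(m, n). ln (real (card (kings (Suc m) (Suc n)))) / (real (Suc m) * real (Suc n))) \<longlongrightarrow> L)
      (sequentially \<times>\<^sub>F sequentially)"
    and le: "\<And>k. real (card (configs A (Suc k) (Suc r))) \<le> C * \<mu> ^ k"
    and "\<mu> > 0" "r > 0"
  shows "L \<le> ln \<mu> / (2 * real r)"
proof (rule LIMSEQ_le)
  have diag: "filterlim (\<lambda>k::nat. (r * Suc k, k)) (sequentially \<times>\<^sub>F sequentially) sequentially"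
  proof (rule filterlim_Pair)
    have "k \<le> r * Suc k" for k using \<open>r > 0\<close> by (cases r) auto
    then show "filterlim (\<lambda>k. r * Suc k) sequentially sequentially"
      by (intro filterlim_at_top_mono [OF filterlim_ident]) simp
  qed (rule filterlim_ident)
  show "(\<lambda>k. ln (real (card (kings (Suc (r * Suc k)) (Suc k)))) / (real (Suc (r * Suc k)) * real (Suc k))) \<longlonglongrightarrow> L"
    using filterlim_compose [OF L diag] by simp
  define D where "D = ln (real (card (kings 1 1)))"
  have lim: "(\<lambda>k. (real (Suc k) * D + real (Suc k) * (ln C + real k * ln \<mu>) / 2) / ((1 + x * real (Suc k)) * real (Suc k)))
      \<longlonglongrightarrow> ln \<mu> * inverse x / 2" if "x > 0" for x :: real
    using that by real_asymp
  show "(\<lambda>k. (real (Suc k) * D + real (Suc k) * (ln C + real k * ln \<mu>) / 2) / (real (Suc (r * Suc k)) * real (Suc k)))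
      \<longlonglongrightarrow> ln \<mu> / (2 * real r)"
    using lim [of "real r"] \<open>r > 0\<close> by (simp add: field_simps)
  have "ln (real (card (kings (Suc (r * Suc k)) (Suc k))))
      \<le> real (Suc k) * D + real (Suc k) * (ln C + real k * ln \<mu>) / 2" for k
  proof -
    let ?X = "cols (\<lambda>_. UNIV) (Suc k) :: (nat \<Rightarrow> bool) set"
    have pos: "real (card (kings a n)) > 0" for a n using card_kings_pos [of a n] by simp
    have Fle: "walks_frobenius ?X fits r \<le> C * \<mu> ^ k"
      using le [of k] walks_frobenius_eq_card [OF \<open>r > 0\<close>, of "Suc k"] by (simp add: A_def)
    have "(real (card (kings (Suc (r * Suc k)) (Suc k))))\<^sup>2
        \<le> (real (card ?X))\<^sup>2 * walks_frobenius ?X fits (r * Suc k)"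
      unfolding card_configs by (rule total_walks_le_frobenius)
    also have "\<dots> \<le> (real (card (kings 1 (Suc k))))\<^sup>2 * (C * \<mu> ^ k) ^ Suc k"
      unfolding card_cols
      by (intro mult_left_mono order.trans [OF walks_frobenius_mult_le [OF finite_cols]] power_mono Fle
          walks_frobenius_nonneg) auto
    finally have *: "(real (card (kings (Suc (r * Suc k)) (Suc k))))\<^sup>2
        \<le> (real (card (kings 1 (Suc k))))\<^sup>2 * (C * \<mu> ^ k) ^ Suc k" .
    \<comment> \<open>The logarithms below need \<open>C > 0\<close>. It is forced: the right-hand
      side dominates a positive square, and nonnegativity from \<open>Fle\<close> settles the sign
      when the exponent is even.\<close>
    then have "0 < (real (card (kings 1 (Suc k))))\<^sup>2 * (C * \<mu> ^ k) ^ Suc k"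
      using pos by (metis less_le_trans zero_less_power)
    then have "C * \<mu> ^ k \<noteq> 0" by (metis less_irrefl mult_zero_right power_0_Suc)
    moreover have "C * \<mu> ^ k \<ge> 0" using Fle walks_frobenius_nonneg order.trans by blast
    ultimately have C: "C * \<mu> ^ k > 0" by linarith
    then have "C > 0" using zero_less_power [OF \<open>\<mu> > 0\<close>, of k] by (auto simp only: zero_less_mult_iff)
    have "2 * ln (real (card (kings (Suc (r * Suc k)) (Suc k))))
        = ln ((real (card (kings (Suc (r * Suc k)) (Suc k))))\<^sup>2)"
      using pos by (simp add: ln_realpow)
    also have "\<dots> \<le> ln ((real (card (kings 1 (Suc k))))\<^sup>2 * (C * \<mu> ^ k) ^ Suc k)"
      using * pos by (intro ln_mono) auto
    also have "\<dots> = 2 * ln (real (card (kings 1 (Suc k)))) + real (Suc k) * (ln C + real k * ln \<mu>)"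
    proof -
      have "ln (C * \<mu> ^ k) = ln C + real k * ln \<mu>"
        using \<open>C > 0\<close> \<open>\<mu> > 0\<close> by (simp add: ln_mult ln_realpow)
      moreover have "ln ((C * \<mu> ^ k) ^ Suc k) = real (Suc k) * ln (C * \<mu> ^ k)"
        by (rule ln_realpow)
      moreover have "ln ((real (card (kings 1 (Suc k))))\<^sup>2) = 2 * ln (real (card (kings 1 (Suc k))))"
        using pos by (simp add: ln_realpow)
      ultimately show ?thesis
        by (simp only: ln_mult_pos [OF zero_less_power [OF pos] zero_less_power [OF C]])
    qed
    \<comment> \<open>The number of single columns is at most exponential in their height, so this
      term is linear in \<open>k\<close> after the logarithm and vanishes in the limit.\<close>
    also have "ln (real (card (kings 1 (Suc k)))) \<le> real (Suc k) * D"
      using log_kings.le_mult_one [of 1 "Suc k"] by (simp add: D_def)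
    finally show ?thesis by simp
  qed
  then show "\<exists>N. \<forall>k\<ge>N. ln (real (card (kings (Suc (r * Suc k)) (Suc k)))) / (real (Suc (r * Suc k)) * real (Suc k))
      \<le> (real (Suc k) * D + real (Suc k) * (ln C + real k * ln \<mu>) / 2) / (real (Suc (r * Suc k)) * real (Suc k))"
    by (intro exI [of _ 0] allI impI divide_right_mono) auto
qed

subsection \<open>Approximate eigenvectors\<close>

abbreviation (input) "node2 t u \<equiv> Node [(False, t), (True, u)]"
abbreviation (input) "node1 t \<equiv> Node [(False, t)]"
abbreviation (input) "leaf2 v w \<equiv> node2 (Leaf v) (Leaf w)"
abbreviation (input) "leaf1 v \<equiv> node1 (Leaf v)"

text \<open>The last letter dictates the branching at inner heights: \<open>pairs01\<close> follows
  \<open>(False, True)\<close>, \<open>pairs10\<close> follows \<open>(True, False)\<close> and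
  \<open>pairs0\<close> follows \<open>(True, True)\<close>. \<open>pairs_eq\<close> belongs to the
  two folds.\<close>

abbreviation (input) "pairs4 t u v w \<equiv>
  Node [((False, False), t), ((False, True), u), ((True, False), v), ((True, True), w)]"
abbreviation (input) "pairs01 t u \<equiv> Node [((False, False), t), ((True, False), u)]"
abbreviation (input) "pairs10 t u \<equiv> Node [((False, False), t), ((False, True), u)]"
abbreviation (input) "pairs_eq t u \<equiv> Node [((False, False), t), ((True, True), u)]"
abbreviation (input) "pairs0 t \<equiv> Node [((False, False), t)]"
abbreviation (input) "last_eq v w \<equiv> pairs_eq (Leaf v) (Leaf w)"
abbreviation (input) "last0 v \<equiv> pairs0 (Leaf v)"

text \<open>Rounded Perron eigenvectors of the transfer matrices of the strips of heights 11 and 13 and of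
  the cylinder of circumference 12, the latter in the encoding of \<open>walks_frobenius_eq_card\<close>.\<close>

definition weights11 :: "bool wtree" where
  "weights11 =
    (node2 (node2 (node2 (node2 (node2 (node2 (node2 (node2 (node2 (node2 (leaf2 292720 156277)
    (leaf1 114809)) (node1 (leaf2 132293 86133))) (node1 (node2 (leaf2 123012 63818) (leaf1
    63818)))) (node1 (node2 (node2 (leaf2 127889 69509) (leaf1 47800)) (node1 (leaf2 73336
    47800))))) (node1 (node2 (node2 (node2 (leaf2 124618 66108) (leaf1 50183)) (node1 (leaf2
    54119 35286))) (node1 (node2 (leaf2 67971 35286) (leaf1 35286)))))) (node1 (node2 (node2
    (node2 (node2 (leaf2 127889 68489) (leaf1 49670)) (node1 (leaf2 59111 38462))) (node1 (node2
    (leaf2 51468 26723) (leaf1 26723)))) (node1 (node2 (node2 (leaf2 71426 38811) (leaf1 26723))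
    (node1 (leaf2 40992 26723))))))) (node1 (node2 (node2 (node2 (node2 (node2 (leaf2 123012
    65581) (leaf1 48484)) (node1 (leaf2 55113 35897))) (node1 (node2 (leaf2 53009 27491) (leaf1
    27491)))) (node1 (node2 (node2 (leaf2 51468 27964) (leaf1 19261)) (node1 (leaf2 29544
    19261))))) (node1 (node2 (node2 (node2 (leaf2 67971 36063) (leaf1 27360)) (node1 (leaf2
    29544 19261))) (node1 (node2 (leaf2 37099 19261) (leaf1 19261)))))))) (node1 (node2 (node2
    (node2 (node2 (node2 (node2 (leaf2 132293 70672) (leaf1 51783)) (node1 (leaf2 60023 39073)))
    (node1 (node2 (leaf2 55113 28598) (leaf1 28598)))) (node1 (node2 (node2 (leaf2 59111 32133)
    (leaf1 22082)) (node1 (leaf2 33883 22082))))) (node1 (node2 (node2 (node2 (leaf2 54119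
    28715) (leaf1 21782)) (node1 (leaf2 23528 15339))) (node1 (node2 (leaf2 29544 15339) (leaf1
    15339)))))) (node1 (node2 (node2 (node2 (node2 (leaf2 73336 39271) (leaf1 28490)) (node1
    (leaf2 33883 22048))) (node1 (node2 (leaf2 29544 15339) (leaf1 15339)))) (node1 (node2
    (node2 (leaf2 40992 22273) (leaf1 15339)) (node1 (leaf2 23528 15339))))))))) (node1 (node2
    (node2 (node2 (node2 (node2 (node2 (node2 (leaf2 114809 61274) (leaf1 45079)) (node1 (leaf2
    51783 33718))) (node1 (node2 (leaf2 48484 25151) (leaf1 25151)))) (node1 (node2 (node2
    (leaf2 49670 26993) (leaf1 18571)) (node1 (leaf2 28490 18571))))) (node1 (node2 (node2
    (node2 (leaf2 50183 26618) (leaf1 20216)) (node1 (leaf2 21782 14202))) (node1 (node2 (leaf2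
    27360 14202) (leaf1 14202)))))) (node1 (node2 (node2 (node2 (node2 (leaf2 47800 25596)
    (leaf1 18571)) (node1 (leaf2 22082 14369))) (node1 (node2 (leaf2 19261 10000) (leaf1
    10000)))) (node1 (node2 (node2 (leaf2 26723 14519) (leaf1 10000)) (node1 (leaf2 15339
    10000))))))) (node1 (node2 (node2 (node2 (node2 (node2 (leaf2 63818 34024) (leaf1 25151))
    (node1 (leaf2 28598 18626))) (node1 (node2 (leaf2 27491 14257) (leaf1 14257)))) (node1
    (node2 (node2 (leaf2 26723 14519) (leaf1 10000)) (node1 (leaf2 15339 10000))))) (node1
    (node2 (node2 (node2 (leaf2 35286 18722) (leaf1 14202)) (node1 (leaf2 15339 10000))) (node1
    (node2 (leaf2 19261 10000) (leaf1 10000)))))))))) (node1 (node2 (node2 (node2 (node2 (node2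
    (node2 (node2 (node2 (leaf2 156277 83442) (leaf1 61274)) (node1 (leaf2 70672 46011))) (node1
    (node2 (leaf2 65581 34024) (leaf1 34024)))) (node1 (node2 (node2 (leaf2 68489 37226) (leaf1
    25596)) (node1 (leaf2 39271 25596))))) (node1 (node2 (node2 (node2 (leaf2 66108 35071)
    (leaf1 26618)) (node1 (leaf2 28715 18722))) (node1 (node2 (leaf2 36063 18722) (leaf1
    18722)))))) (node1 (node2 (node2 (node2 (node2 (leaf2 69509 37226) (leaf1 26993)) (node1
    (leaf2 32133 20908))) (node1 (node2 (leaf2 27964 14519) (leaf1 14519)))) (node1 (node2
    (node2 (leaf2 38811 21089) (leaf1 14519)) (node1 (leaf2 22273 14519))))))) (node1 (node2
    (node2 (node2 (node2 (node2 (leaf2 63818 34024) (leaf1 25151)) (node1 (leaf2 28598 18626)))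
    (node1 (node2 (leaf2 27491 14257) (leaf1 14257)))) (node1 (node2 (node2 (leaf2 26723 14519)
    (leaf1 10000)) (node1 (leaf2 15339 10000))))) (node1 (node2 (node2 (node2 (leaf2 35286
    18722) (leaf1 14202)) (node1 (leaf2 15339 10000))) (node1 (node2 (leaf2 19261 10000) (leaf1
    10000)))))))) (node1 (node2 (node2 (node2 (node2 (node2 (node2 (leaf2 86133 46011) (leaf1
    33718)) (node1 (leaf2 39073 25435))) (node1 (node2 (leaf2 35897 18626) (leaf1 18626))))
    (node1 (node2 (node2 (leaf2 38462 20908) (leaf1 14369)) (node1 (leaf2 22048 14369)))))
    (node1 (node2 (node2 (node2 (leaf2 35286 18722) (leaf1 14202)) (node1 (leaf2 15339 10000)))
    (node1 (node2 (leaf2 19261 10000) (leaf1 10000)))))) (node1 (node2 (node2 (node2 (node2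
    (leaf2 47800 25596) (leaf1 18571)) (node1 (leaf2 22082 14369))) (node1 (node2 (leaf2 19261
    10000) (leaf1 10000)))) (node1 (node2 (node2 (leaf2 26723 14519) (leaf1 10000)) (node1
    (leaf2 15339 10000)))))))))))"

definition weights13 :: "bool wtree" where
  "weights13 =
    (node2 (node2 (node2 (node2 (node2 (node2 (node2 (node2 (node2 (node2 (node2 (node2 (leaf2
    527649 281674) (leaf1 207012)) (node1 (leaf2 238346 155187))) (node1 (node2 (leaf2 221983
    115158) (leaf1 115158)))) (node1 (node2 (node2 (leaf2 230040 125022) (leaf1 85993)) (node1
    (leaf2 131927 85993))))) (node1 (node2 (node2 (node2 (leaf2 225605 119672) (leaf1 90866))
    (node1 (leaf2 97950 63866))) (node1 (node2 (leaf2 123029 63866) (leaf1 63866)))))) (node1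
    (node2 (node2 (node2 (node2 (leaf2 228552 122390) (leaf1 88783)) (node1 (leaf2 105606
    68717))) (node1 (node2 (leaf2 92029 47781) (leaf1 47781)))) (node1 (node2 (node2 (leaf2
    127693 69382) (leaf1 47781)) (node1 (leaf2 73291 47781))))))) (node1 (node2 (node2 (node2
    (node2 (node2 (leaf2 225605 120268) (leaf1 88939)) (node1 (leaf2 101044 65814))) (node1
    (node2 (leaf2 97284 50451) (leaf1 50451)))) (node1 (node2 (node2 (leaf2 94292 51229) (leaf1
    35292)) (node1 (leaf2 54131 35292))))) (node1 (node2 (node2 (node2 (leaf2 124568 66088)
    (leaf1 50151)) (node1 (leaf2 54131 35292))) (node1 (node2 (leaf2 67979 35292) (leaf1
    35292)))))))) (node1 (node2 (node2 (node2 (node2 (node2 (node2 (leaf2 230040 122881) (leaf1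
    90062)) (node1 (leaf2 104336 67921))) (node1 (node2 (leaf2 95900 49760) (leaf1 49760))))
    (node1 (node2 (node2 (leaf2 102664 55807) (leaf1 38357)) (node1 (leaf2 58853 38357)))))
    (node1 (node2 (node2 (node2 (leaf2 94292 50028) (leaf1 37956)) (node1 (leaf2 40984 26720)))
    (node1 (node2 (leaf2 51466 26720) (leaf1 26720)))))) (node1 (node2 (node2 (node2 (node2
    (leaf2 127693 68375) (leaf1 49616)) (node1 (leaf2 58981 38380))) (node1 (node2 (leaf2 51466
    26720) (leaf1 26720)))) (node1 (node2 (node2 (leaf2 71398 38792) (leaf1 26720)) (node1
    (leaf2 40984 26720))))))))) (node1 (node2 (node2 (node2 (node2 (node2 (node2 (node2 (leaf2
    221983 118464) (leaf1 87180)) (node1 (leaf2 100085 65171))) (node1 (node2 (leaf2 93819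
    48665) (leaf1 48665)))) (node1 (node2 (node2 (leaf2 95900 52114) (leaf1 35861)) (node1
    (leaf2 55012 35861))))) (node1 (node2 (node2 (node2 (leaf2 97284 51598) (leaf1 39196))
    (node1 (leaf2 42216 27527))) (node1 (node2 (leaf2 53032 27527) (leaf1 27527)))))) (node1
    (node2 (node2 (node2 (node2 (leaf2 92029 49276) (leaf1 35761)) (node1 (leaf2 42502 27657)))
    (node1 (node2 (leaf2 37101 19262) (leaf1 19262)))) (node1 (node2 (node2 (leaf2 51466 27962)
    (leaf1 19262)) (node1 (leaf2 29544 19262))))))) (node1 (node2 (node2 (node2 (node2 (node2
    (leaf2 123029 65588) (leaf1 48496)) (node1 (leaf2 55114 35898))) (node1 (node2 (leaf2 53032
    27502) (leaf1 27502)))) (node1 (node2 (node2 (leaf2 51466 27962) (leaf1 19262)) (node1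
    (leaf2 29544 19262))))) (node1 (node2 (node2 (node2 (leaf2 67979 36066) (leaf1 27366))
    (node1 (leaf2 29544 19262))) (node1 (node2 (leaf2 37101 19262) (leaf1 19262)))))))))) (node1
    (node2 (node2 (node2 (node2 (node2 (node2 (node2 (node2 (leaf2 238346 127253) (leaf1 93469))
    (node1 (leaf2 107752 70155))) (node1 (node2 (leaf2 100085 51923) (leaf1 51923)))) (node1
    (node2 (node2 (leaf2 104336 56707) (leaf1 38997)) (node1 (leaf2 59830 38997))))) (node1
    (node2 (node2 (node2 (leaf2 101044 53602) (leaf1 40690)) (node1 (leaf2 43882 28611))) (node1
    (node2 (leaf2 55114 28611) (leaf1 28611)))))) (node1 (node2 (node2 (node2 (node2 (leaf2
    105606 56555) (leaf1 41017)) (node1 (leaf2 48810 31759))) (node1 (node2 (leaf2 42502 22067)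
    (leaf1 22067)))) (node1 (node2 (node2 (leaf2 58981 32048) (leaf1 22067)) (node1 (leaf2 33850
    22067))))))) (node1 (node2 (node2 (node2 (node2 (node2 (leaf2 97950 52219) (leaf1 38609))
    (node1 (leaf2 43882 28582))) (node1 (node2 (leaf2 42216 21893) (leaf1 21893)))) (node1
    (node2 (node2 (leaf2 40984 22267) (leaf1 15338)) (node1 (leaf2 23526 15338))))) (node1
    (node2 (node2 (node2 (leaf2 54131 28719) (leaf1 21790)) (node1 (leaf2 23526 15338))) (node1
    (node2 (leaf2 29544 15338) (leaf1 15338)))))))) (node1 (node2 (node2 (node2 (node2 (node2
    (node2 (leaf2 131927 70470) (leaf1 51654)) (node1 (leaf2 59830 38949))) (node1 (node2 (leaf2
    55012 28544) (leaf1 28544)))) (node1 (node2 (node2 (leaf2 58853 31991) (leaf1 21989)) (node1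
    (leaf2 33739 21989))))) (node1 (node2 (node2 (node2 (leaf2 54131 28719) (leaf1 21790))
    (node1 (leaf2 23526 15338))) (node1 (node2 (leaf2 29544 15338) (leaf1 15338)))))) (node1
    (node2 (node2 (node2 (node2 (leaf2 73291 39244) (leaf1 28479)) (node1 (leaf2 33850 22027)))
    (node1 (node2 (leaf2 29544 15338) (leaf1 15338)))) (node1 (node2 (node2 (leaf2 40984 22267)
    (leaf1 15338)) (node1 (leaf2 23526 15338))))))))))) (node1 (node2 (node2 (node2 (node2
    (node2 (node2 (node2 (node2 (node2 (leaf2 207012 110501) (leaf1 81237)) (node1 (leaf2 93469
    60859))) (node1 (node2 (leaf2 87180 45225) (leaf1 45225)))) (node1 (node2 (node2 (leaf2
    90062 48945) (leaf1 33670)) (node1 (leaf2 51654 33670))))) (node1 (node2 (node2 (node2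
    (leaf2 88939 47176) (leaf1 35825)) (node1 (leaf2 38609 25174))) (node1 (node2 (leaf2 48496
    25174) (leaf1 25174)))))) (node1 (node2 (node2 (node2 (node2 (leaf2 88783 47542) (leaf1
    34492)) (node1 (leaf2 41017 26690))) (node1 (node2 (leaf2 35761 18567) (leaf1 18567))))
    (node1 (node2 (node2 (leaf2 49616 26958) (leaf1 18567)) (node1 (leaf2 28479 18567)))))))
    (node1 (node2 (node2 (node2 (node2 (node2 (leaf2 90866 48439) (leaf1 35825)) (node1 (leaf2
    40690 26504))) (node1 (node2 (leaf2 39196 20326) (leaf1 20326)))) (node1 (node2 (node2
    (leaf2 37956 20621) (leaf1 14207)) (node1 (leaf2 21790 14207))))) (node1 (node2 (node2
    (node2 (leaf2 50151 26606) (leaf1 20192)) (node1 (leaf2 21790 14207))) (node1 (node2 (leaf2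
    27366 14207) (leaf1 14207)))))))) (node1 (node2 (node2 (node2 (node2 (node2 (node2 (leaf2
    85993 45934) (leaf1 33670)) (node1 (leaf2 38997 25387))) (node1 (node2 (leaf2 35861 18607)
    (leaf1 18607)))) (node1 (node2 (node2 (leaf2 38357 20850) (leaf1 14332)) (node1 (leaf2 21989
    14332))))) (node1 (node2 (node2 (node2 (leaf2 35292 18724) (leaf1 14207)) (node1 (leaf2
    15338 10000))) (node1 (node2 (leaf2 19262 10000) (leaf1 10000)))))) (node1 (node2 (node2
    (node2 (node2 (leaf2 47781 25584) (leaf1 18567)) (node1 (leaf2 22067 14360))) (node1 (node2
    (leaf2 19262 10000) (leaf1 10000)))) (node1 (node2 (node2 (leaf2 26720 14517) (leaf1 10000))
    (node1 (leaf2 15338 10000))))))))) (node1 (node2 (node2 (node2 (node2 (node2 (node2 (node2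
    (leaf2 115158 61456) (leaf1 45225)) (node1 (leaf2 51923 33810))) (node1 (node2 (leaf2 48665
    25244) (leaf1 25244)))) (node1 (node2 (node2 (leaf2 49760 27041) (leaf1 18607)) (node1
    (leaf2 28544 18607))))) (node1 (node2 (node2 (node2 (leaf2 50451 26759) (leaf1 20326))
    (node1 (leaf2 21893 14276))) (node1 (node2 (leaf2 27502 14276) (leaf1 14276)))))) (node1
    (node2 (node2 (node2 (node2 (leaf2 47781 25584) (leaf1 18567)) (node1 (leaf2 22067 14360)))
    (node1 (node2 (leaf2 19262 10000) (leaf1 10000)))) (node1 (node2 (node2 (leaf2 26720 14517)
    (leaf1 10000)) (node1 (leaf2 15338 10000))))))) (node1 (node2 (node2 (node2 (node2 (node2
    (leaf2 63866 34048) (leaf1 25174)) (node1 (leaf2 28611 18635))) (node1 (node2 (leaf2 27527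
    14276) (leaf1 14276)))) (node1 (node2 (node2 (leaf2 26720 14517) (leaf1 10000)) (node1
    (leaf2 15338 10000))))) (node1 (node2 (node2 (node2 (leaf2 35292 18724) (leaf1 14207))
    (node1 (leaf2 15338 10000))) (node1 (node2 (leaf2 19262 10000) (leaf1 10000))))))))))))
    (node1 (node2 (node2 (node2 (node2 (node2 (node2 (node2 (node2 (node2 (node2 (leaf2 281674
    150369) (leaf1 110501)) (node1 (leaf2 127253 82854))) (node1 (node2 (leaf2 118464 61456)
    (leaf1 61456)))) (node1 (node2 (node2 (leaf2 122881 66784) (leaf1 45934)) (node1 (leaf2
    70470 45934))))) (node1 (node2 (node2 (node2 (leaf2 120268 63797) (leaf1 48439)) (node1
    (leaf2 52219 34048))) (node1 (node2 (leaf2 65588 34048) (leaf1 34048)))))) (node1 (node2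
    (node2 (node2 (node2 (leaf2 122390 65541) (leaf1 47542)) (node1 (leaf2 56555 36800))) (node1
    (node2 (leaf2 49276 25584) (leaf1 25584)))) (node1 (node2 (node2 (leaf2 68375 37151) (leaf1
    25584)) (node1 (leaf2 39244 25584))))))) (node1 (node2 (node2 (node2 (node2 (node2 (leaf2
    119672 63797) (leaf1 47176)) (node1 (leaf2 53602 34913))) (node1 (node2 (leaf2 51598 26759)
    (leaf1 26759)))) (node1 (node2 (node2 (leaf2 50028 27180) (leaf1 18724)) (node1 (leaf2 28719
    18724))))) (node1 (node2 (node2 (node2 (leaf2 66088 35062) (leaf1 26606)) (node1 (leaf2
    28719 18724))) (node1 (node2 (leaf2 36066 18724) (leaf1 18724)))))))) (node1 (node2 (node2
    (node2 (node2 (node2 (node2 (leaf2 125022 66784) (leaf1 48945)) (node1 (leaf2 56707 36916)))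
    (node1 (node2 (leaf2 52114 27041) (leaf1 27041)))) (node1 (node2 (node2 (leaf2 55807 30336)
    (leaf1 20850)) (node1 (leaf2 31991 20850))))) (node1 (node2 (node2 (node2 (leaf2 51229
    27180) (leaf1 20621)) (node1 (leaf2 22267 14517))) (node1 (node2 (leaf2 27962 14517) (leaf1
    14517)))))) (node1 (node2 (node2 (node2 (node2 (leaf2 69382 37151) (leaf1 26958)) (node1
    (leaf2 32048 20854))) (node1 (node2 (leaf2 27962 14517) (leaf1 14517)))) (node1 (node2
    (node2 (leaf2 38792 21076) (leaf1 14517)) (node1 (leaf2 22267 14517))))))))) (node1 (node2
    (node2 (node2 (node2 (node2 (node2 (node2 (leaf2 115158 61456) (leaf1 45225)) (node1 (leaf2
    51923 33810))) (node1 (node2 (leaf2 48665 25244) (leaf1 25244)))) (node1 (node2 (node2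
    (leaf2 49760 27041) (leaf1 18607)) (node1 (leaf2 28544 18607))))) (node1 (node2 (node2
    (node2 (leaf2 50451 26759) (leaf1 20326)) (node1 (leaf2 21893 14276))) (node1 (node2 (leaf2
    27502 14276) (leaf1 14276)))))) (node1 (node2 (node2 (node2 (node2 (leaf2 47781 25584)
    (leaf1 18567)) (node1 (leaf2 22067 14360))) (node1 (node2 (leaf2 19262 10000) (leaf1
    10000)))) (node1 (node2 (node2 (leaf2 26720 14517) (leaf1 10000)) (node1 (leaf2 15338
    10000))))))) (node1 (node2 (node2 (node2 (node2 (node2 (leaf2 63866 34048) (leaf1 25174))
    (node1 (leaf2 28611 18635))) (node1 (node2 (leaf2 27527 14276) (leaf1 14276)))) (node1
    (node2 (node2 (leaf2 26720 14517) (leaf1 10000)) (node1 (leaf2 15338 10000))))) (node1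
    (node2 (node2 (node2 (leaf2 35292 18724) (leaf1 14207)) (node1 (leaf2 15338 10000))) (node1
    (node2 (leaf2 19262 10000) (leaf1 10000)))))))))) (node1 (node2 (node2 (node2 (node2 (node2
    (node2 (node2 (node2 (leaf2 155187 82854) (leaf1 60859)) (node1 (leaf2 70155 45676))) (node1
    (node2 (leaf2 65171 33810) (leaf1 33810)))) (node1 (node2 (node2 (leaf2 67921 36916) (leaf1
    25387)) (node1 (leaf2 38949 25387))))) (node1 (node2 (node2 (node2 (leaf2 65814 34913)
    (leaf1 26504)) (node1 (leaf2 28582 18635))) (node1 (node2 (leaf2 35898 18635) (leaf1
    18635)))))) (node1 (node2 (node2 (node2 (node2 (leaf2 68717 36800) (leaf1 26690)) (node1
    (leaf2 31759 20665))) (node1 (node2 (leaf2 27657 14360) (leaf1 14360)))) (node1 (node2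
    (node2 (leaf2 38380 20854) (leaf1 14360)) (node1 (leaf2 22027 14360))))))) (node1 (node2
    (node2 (node2 (node2 (node2 (leaf2 63866 34048) (leaf1 25174)) (node1 (leaf2 28611 18635)))
    (node1 (node2 (leaf2 27527 14276) (leaf1 14276)))) (node1 (node2 (node2 (leaf2 26720 14517)
    (leaf1 10000)) (node1 (leaf2 15338 10000))))) (node1 (node2 (node2 (node2 (leaf2 35292
    18724) (leaf1 14207)) (node1 (leaf2 15338 10000))) (node1 (node2 (leaf2 19262 10000) (leaf1
    10000)))))))) (node1 (node2 (node2 (node2 (node2 (node2 (node2 (leaf2 85993 45934) (leaf1
    33670)) (node1 (leaf2 38997 25387))) (node1 (node2 (leaf2 35861 18607) (leaf1 18607))))
    (node1 (node2 (node2 (leaf2 38357 20850) (leaf1 14332)) (node1 (leaf2 21989 14332)))))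
    (node1 (node2 (node2 (node2 (leaf2 35292 18724) (leaf1 14207)) (node1 (leaf2 15338 10000)))
    (node1 (node2 (leaf2 19262 10000) (leaf1 10000)))))) (node1 (node2 (node2 (node2 (node2
    (leaf2 47781 25584) (leaf1 18567)) (node1 (leaf2 22067 14360))) (node1 (node2 (leaf2 19262
    10000) (leaf1 10000)))) (node1 (node2 (node2 (leaf2 26720 14517) (leaf1 10000)) (node1
    (leaf2 15338 10000)))))))))))))"

definition weights_cylinder :: "(bool \<times> bool) wtree" where
  "weights_cylinder =
    (pairs_eq (pairs4 (pairs4 (pairs4 (pairs4 (pairs4 (last_eq 3432130392 1478067726) (last0
    1478067726) (last0 1478067726) (last0 819320159)) (pairs01 (last_eq 1478067726 819320159)
    (last0 609731153)) (pairs10 (last_eq 1478067726 819320159) (last0 609731153)) (pairs0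
    (last_eq 652569020 454737932))) (pairs01 (pairs4 (last_eq 1478067726 609731153) (last0
    819320159) (last0 652569020) (last0 454737932)) (pairs10 (last_eq 629599630 337771921)
    (last0 337771921))) (pairs10 (pairs4 (last_eq 1478067726 609731153) (last0 652569020) (last0
    819320159) (last0 454737932)) (pairs01 (last_eq 629599630 337771921) (last0 337771921)))
    (pairs0 (pairs4 (last_eq 642118403 253068874) (last0 362771173) (last0 362771173) (last0
    253068874)))) (pairs01 (pairs4 (pairs4 (last_eq 1478067726 652569020) (last0 609731153)
    (last0 629599630) (last0 337771921)) (pairs01 (last_eq 819320159 454737932) (last0
    337771921)) (pairs10 (last_eq 642118403 362771173) (last0 253068874)) (pairs0 (last_eq
    362771173 253068874))) (pairs10 (pairs4 (last_eq 629599630 266554623) (last0 266554623)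
    (last0 346673541) (last0 186131210)) (pairs01 (last_eq 346673541 186131210) (last0
    186131210)))) (pairs10 (pairs4 (pairs4 (last_eq 1478067726 652569020) (last0 629599630)
    (last0 609731153) (last0 337771921)) (pairs01 (last_eq 642118403 362771173) (last0
    253068874)) (pairs10 (last_eq 819320159 454737932) (last0 337771921)) (pairs0 (last_eq
    362771173 253068874))) (pairs01 (pairs4 (last_eq 629599630 266554623) (last0 346673541)
    (last0 266554623) (last0 186131210)) (pairs10 (last_eq 346673541 186131210) (last0
    186131210)))) (pairs0 (pairs4 (pairs4 (last_eq 652569020 294827617) (last0 266554623) (last0
    266554623) (last0 143065605)) (pairs01 (last_eq 362771173 205144737) (last0 143065605))
    (pairs10 (last_eq 362771173 205144737) (last0 143065605)) (pairs0 (last_eq 204840243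
    143065605))))) (pairs01 (pairs4 (pairs4 (pairs4 (last_eq 1478067726 629599630) (last0
    652569020) (last0 642118403) (last0 362771173)) (pairs01 (last_eq 609731153 337771921)
    (last0 253068874)) (pairs10 (last_eq 629599630 346673541) (last0 266554623)) (pairs0
    (last_eq 266554623 186131210))) (pairs01 (pairs4 (last_eq 819320159 337771921) (last0
    454737932) (last0 362771173) (last0 253068874)) (pairs10 (last_eq 346673541 186131210)
    (last0 186131210))) (pairs10 (pairs4 (last_eq 652569020 266554623) (last0 294827617) (last0
    362771173) (last0 205144737)) (pairs01 (last_eq 266554623 143065605) (last0 143065605)))
    (pairs0 (pairs4 (last_eq 362771173 143065605) (last0 205144737) (last0 204840243) (last0
    143065605)))) (pairs10 (pairs4 (pairs4 (last_eq 609731153 266554623) (last0 266554623)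
    (last0 253068874) (last0 143065605)) (pairs01 (last_eq 253068874 143065605) (last0
    100000000)) (pairs10 (last_eq 337771921 186131210) (last0 143065605)) (pairs0 (last_eq
    143065605 100000000))) (pairs01 (pairs4 (last_eq 337771921 143065605) (last0 186131210)
    (last0 143065605) (last0 100000000)) (pairs10 (last_eq 186131210 100000000) (last0
    100000000))))) (pairs10 (pairs4 (pairs4 (pairs4 (last_eq 1478067726 629599630) (last0
    642118403) (last0 652569020) (last0 362771173)) (pairs01 (last_eq 629599630 346673541)
    (last0 266554623)) (pairs10 (last_eq 609731153 337771921) (last0 253068874)) (pairs0
    (last_eq 266554623 186131210))) (pairs01 (pairs4 (last_eq 652569020 266554623) (last0
    362771173) (last0 294827617) (last0 205144737)) (pairs10 (last_eq 266554623 143065605)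
    (last0 143065605))) (pairs10 (pairs4 (last_eq 819320159 337771921) (last0 362771173) (last0
    454737932) (last0 253068874)) (pairs01 (last_eq 346673541 186131210) (last0 186131210)))
    (pairs0 (pairs4 (last_eq 362771173 143065605) (last0 204840243) (last0 205144737) (last0
    143065605)))) (pairs01 (pairs4 (pairs4 (last_eq 609731153 266554623) (last0 253068874)
    (last0 266554623) (last0 143065605)) (pairs01 (last_eq 337771921 186131210) (last0
    143065605)) (pairs10 (last_eq 253068874 143065605) (last0 100000000)) (pairs0 (last_eq
    143065605 100000000))) (pairs10 (pairs4 (last_eq 337771921 143065605) (last0 143065605)
    (last0 186131210) (last0 100000000)) (pairs01 (last_eq 186131210 100000000) (last0
    100000000))))) (pairs0 (pairs4 (pairs4 (pairs4 (last_eq 819320159 346673541) (last0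
    362771173) (last0 362771173) (last0 204840243)) (pairs01 (last_eq 337771921 186131210)
    (last0 143065605)) (pairs10 (last_eq 337771921 186131210) (last0 143065605)) (pairs0
    (last_eq 143065605 100000000))) (pairs01 (pairs4 (last_eq 454737932 186131210) (last0
    253068874) (last0 205144737) (last0 143065605)) (pairs10 (last_eq 186131210 100000000)
    (last0 100000000))) (pairs10 (pairs4 (last_eq 454737932 186131210) (last0 205144737) (last0
    253068874) (last0 143065605)) (pairs01 (last_eq 186131210 100000000) (last0 100000000)))
    (pairs0 (pairs4 (last_eq 253068874 100000000) (last0 143065605) (last0 143065605) (last0
    100000000)))))) (pairs0 (pairs4 (pairs4 (pairs4 (pairs4 (last_eq 1478067726 642118403)
    (last0 629599630) (last0 629599630) (last0 346673541)) (pairs01 (last_eq 652569020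
    362771173) (last0 266554623)) (pairs10 (last_eq 652569020 362771173) (last0 266554623))
    (pairs0 (last_eq 294827617 205144737))) (pairs01 (pairs4 (last_eq 609731153 253068874)
    (last0 337771921) (last0 266554623) (last0 186131210)) (pairs10 (last_eq 266554623
    143065605) (last0 143065605))) (pairs10 (pairs4 (last_eq 609731153 253068874) (last0
    266554623) (last0 337771921) (last0 186131210)) (pairs01 (last_eq 266554623 143065605)
    (last0 143065605))) (pairs0 (pairs4 (last_eq 253068874 100000000) (last0 143065605) (last0
    143065605) (last0 100000000)))) (pairs01 (pairs4 (pairs4 (last_eq 819320159 362771173)
    (last0 337771921) (last0 346673541) (last0 186131210)) (pairs01 (last_eq 454737932
    253068874) (last0 186131210)) (pairs10 (last_eq 362771173 204840243) (last0 143065605))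
    (pairs0 (last_eq 205144737 143065605))) (pairs10 (pairs4 (last_eq 337771921 143065605)
    (last0 143065605) (last0 186131210) (last0 100000000)) (pairs01 (last_eq 186131210
    100000000) (last0 100000000)))) (pairs10 (pairs4 (pairs4 (last_eq 819320159 362771173)
    (last0 346673541) (last0 337771921) (last0 186131210)) (pairs01 (last_eq 362771173
    204840243) (last0 143065605)) (pairs10 (last_eq 454737932 253068874) (last0 186131210))
    (pairs0 (last_eq 205144737 143065605))) (pairs01 (pairs4 (last_eq 337771921 143065605)
    (last0 186131210) (last0 143065605) (last0 100000000)) (pairs10 (last_eq 186131210
    100000000) (last0 100000000)))) (pairs0 (pairs4 (pairs4 (last_eq 454737932 205144737) (last0
    186131210) (last0 186131210) (last0 100000000)) (pairs01 (last_eq 253068874 143065605)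
    (last0 100000000)) (pairs10 (last_eq 253068874 143065605) (last0 100000000)) (pairs0
    (last_eq 143065605 100000000)))))))"

section \<open>Evaluating the checks\<close>

lemma clash_free_bool_simps:
  "clash_free True True \<longleftrightarrow> False" "clash_free False x \<longleftrightarrow> True" "clash_free x False \<longleftrightarrow> True"
  by (simp_all add: clash_free_bool)

text \<open>Complete for evaluation with \<open>simp only\<close>: rules for the traversal and for
  clashes of concrete letters, numeral arithmetic and comparison, and propositional
  simplification.\<close>

lemmas check_simps = check.simps checks.simps advance.simps advance_if.simps advance_subtrees.simps
  cons_if.simps subtrees.simps leaf_sum.simps leaf_weight.simps clash_free_bool_simps clash_free_Pair
  bot_bool_def bot_prod_def simp_thms arith_simps rel_simps add_0_left add_0_right mult_1_left mult_1_right

lemma replicate_eq: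
  "replicate 11 x = [x, x, x, x, x, x, x, x, x, x, x]"
  "replicate 13 x = [x, x, x, x, x, x, x, x, x, x, x, x, x]"
  by (simp_all add: numeral_eq_Suc)

lemma shape_weights11: "shape (replicate 11 [False, True]) bot weights11"
  by (simp add: weights11_def clash_free_bool replicate_eq(1))

text \<open>Weight 10000 belongs to columns that only the empty column fits, so the weight 292720 of
  the empty column is the eigenvalue in the same scale. The rate 29.2729 is slightly larger, to
  absorb the rounding of the weights.\<close>

lemma check_weights11: "check (\<lambda>w s. 1 \<le> w \<and> 10000 * s \<le> 292729 * w) bot [(bot, weights11)] weights11"
  unfolding weights11_def by (simp only: check_simps)

lemma shape_weights13: "shape (replicate 13 [False, True]) bot weights13"
  by (simp add: weights13_def clash_free_bool replicate_eq(2))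

text \<open>The eigenvalue is about 52.765; the rate is taken below it since this height stands in
  the numerator.\<close>

lemma check_weights13: "check (\<lambda>w s. 1 \<le> w \<and> 52763 * w \<le> 1000 * s) bot [(bot, weights13)] weights13"
  unfolding weights13_def by (simp only: check_simps)

text \<open>Two folds with one cell each and five inner heights with two cells each make up the
  circumference 12.\<close>

definition cylinder_letters :: "(bool \<times> bool) list list" where
  "cylinder_letters = (let ends = [(False, False), (True, True)];
     inner = [(False, False), (False, True), (True, False), (True, True)]
   in [ends, inner, inner, inner, inner, inner, ends])"

lemma shape_weights_cylinder: "shape cylinder_letters bot weights_cylinder"
  by (simp add: weights_cylinder_def cylinder_letters_def Let_def clash_free_bool bot_prod_def)

text \<open>The weights carry a finer scale than those of the strips because
  \<open>1.342652573 ^ 12\<close> exceeds this rate by less than \<open>1 / 10 ^ 7\<close>.\<close>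

lemma check_weights_cylinder:
  "check (\<lambda>w s. 1 \<le> w \<and> 100000000 * s \<le> 3432130405 * w) bot [(bot, weights_cylinder)] weights_cylinder"
  unfolding weights_cylinder_def by (simp only: check_simps)

theorem mainTheorem4:
  shows "\<exists>\<eta>::real.
    ((\<lambda>(m, n). real (num_indep_sets m n) powr (1 / real ((m + 1) * (n + 1))))
       \<longlongrightarrow> \<eta>) (sequentially \<times>\<^sub>F sequentially) \<and>
    1.342542258 \<le> \<eta> \<and> \<eta> \<le> 1.342652573"
proof -
  obtain L where L: "((\<lambda>(m, n). ln (real (card (kings (Suc m) (Suc n)))) / (real (Suc m) * real (Suc n))) \<longlongrightarrow> L)
      (sequentially \<times>\<^sub>F sequentially)"
    using log_kings.convergent by blast
  have "real (num_indep_sets m n) powr (1 / real ((m + 1) * (n + 1)))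
      = exp (ln (real (card (kings (Suc m) (Suc n)))) / (real (Suc m) * real (Suc n)))" for m n
    using card_kings_pos [of "Suc m" "Suc n"] by (simp add: num_indep_sets_eq powr_def algebra_simps)
  then have lim: "((\<lambda>(m, n). real (num_indep_sets m n) powr (1 / real ((m + 1) * (n + 1))))
       \<longlongrightarrow> exp L) (sequentially \<times>\<^sub>F sequentially)"
    using tendsto_exp [OF L] by (simp add: case_prod_unfold)
  have lower: "ln ((52763 / 1000) / (292729 / 10000)) / 2 \<le> L"
  proof -
    obtain C where "\<And>k. real (card (kings (Suc k) 11)) \<le> C * (real 292729 / real 10000) ^ k"
      using kings_le [OF shape_weights11 check_weights11] by auto
    moreover have "(real 52763 / real 1000) ^ k \<le> real (card (kings (Suc k) 13))" for k
      using kings_ge [OF shape_weights13 check_weights13] by simp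
    \<comment> \<open>With \<open>b = 5\<close> the two heights are \<open>2 * 5 + 1\<close> and
      \<open>2 * 6 + 1\<close>.\<close>
    ultimately show ?thesis
      using kings_rate_lower [OF L, of 5 C "292729 / 10000" "52763 / 1000"] by simp
  qed
  have upper: "L \<le> ln (3432130405 / 100000000) / 12"
  proof -
    let ?A = "\<lambda>j::nat. if j = 0 \<or> j = 6 then {(False, False), (True, True)} else UNIV"
    obtain C where "\<And>k. real (card (configs ?A (Suc k) 7)) \<le> C * (real 3432130405 / real 100000000) ^ k"
    proof (rule card_configs_le [OF shape_weights_cylinder check_weights_cylinder])
      fix j :: nat assume "j < 7"
      then have "j \<in> {0, 1, 2, 3, 4, 5, 6}" by auto
      then show "set (cylinder_letters ! j) = ?A j"
        by (auto simp: cylinder_letters_def Let_def UNIV_bool UNIV_Times_UNIV [symmetric] simp del: UNIV_Times_UNIV)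
    qed (auto simp: cylinder_letters_def Let_def)
    then show ?thesis
      using kings_rate_upper [OF L, of 6 C "3432130405 / 100000000"] by simp
  qed
  \<comment> \<open>The quotient of the rates is about 1.80245 and the square of the bound about
    1.80242; this slack permits strip rates of few digits.\<close>
  have "(1.342542258 :: real) ^ 2 \<le> exp (ln ((52763 / 1000) / (292729 / 10000)))"
    by (simp add: power2_eq_square)
  also have "\<dots> \<le> exp (2 * L)" using lower by (subst exp_le_cancel_iff) linarith
  also have "\<dots> = exp L ^ 2" by (simp add: exp_double)
  finally have "1.342542258 \<le> exp L" by (rule power2_le_imp_le) simp
  moreover have "exp L \<le> 1.342652573"
  proof (rule power_le_imp_le_base)
    \<comment> \<open>The exponent is the circumference 12, written as a successor to match
      \<open>power_le_imp_le_base\<close>; only a comparison of rationals remains.\<close>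
    have "exp L ^ Suc 11 = exp (12 * L)" by (simp add: exp_of_nat_mult [of 12 L, symmetric])
    also have "\<dots> \<le> exp (ln (3432130405 / 100000000))" using upper by (subst exp_le_cancel_iff) linarith
    also have "\<dots> \<le> 1.342652573 ^ Suc 11" by (simp add: power_divide)
    finally show "exp L ^ Suc 11 \<le> 1.342652573 ^ Suc 11" .
  qed simp
  ultimately show ?thesis using lim by blast
qed

end
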